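(* For all integers $n,k$ (with $k$ possibly depending on $n$) and every real $p\in[0,1]$, if $\mathbf{G}\sim\mathcal{G}(n,p,k)$, then asymptotically almost surely every semantic cutting planes refutation of $\mathrm{BinClique}^{\mathrm{block}}(\mathbf{G},k)$ has length at least $$\exp\left(\Omega\left(\min\left(\frac{1}{\sqrt{1-p}},\ \frac{n^{1/4}}{\log(kn)}\right)\right)\right).$$
   Context: Graphs are over $k$ blocks $V_1\sqcup\dots\sqcup V_k$ with $|V_i|=n$, $n$ a power of $2$; each vertex of $V_i$ is identified with its binary representation $\mathsf{bin}(v)=v_1\dots v_{\log n}\in\{0,1\}^{\log n}$. $\mathcal{G}(n,p,k)$: each pair of vertices in different blocks is an edge independently with probability $p$, no edges within blocks. For a Boolean variable $x$, $(x\neq 0)$ denotes the literal $x$ and $(x\neq 1)$ denotes $\overline{x}$. The CNF $\mathrm{BinClique}^{\mathrm{block}}(G,k)$ has variables $x_{i,a}$ for $i\in[k]$, $a\in[\log n]$, and for every $i\neq j$, every $v_i\in V_i$, $v_j\in V_j$ with $\{v_i,v_j\}\notin E(G)$ the clause $\bigvee_{a=1}^{\log n}(x_{i,a}\neq v_{i,a})\vee\bigvee_{a=1}^{\log n}(x_{j,a}\neq v_{j,a})$ (asserting that $v_i,v_j$ are not both chosen as the clique members of blocks $i,j$). A CNF is translated into linear inequalities by adding $0\le x\le 1$ for each variable and $\sum_{i\in I}x_i+\sum_{j\in J}(1-x_j)\ge 1$ for each clause $\bigvee_{i\in I}x_i\vee\bigvee_{j\in J}\overline{x_j}$. A semantic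 cutting planes refutation of a system $Ax\ge b$ is a sequence of linear inequalities $d_\ell x\ge c_\ell$ ($d_\ell\in\mathbb{R}^n$, $c_\ell\in\mathbb{R}$), $\ell\in[L]$, ending with $0\ge 1$, where each inequality is either in the system or is implied over $\{0,1\}^n$ by two earlier inequalities (every $x\in\{0,1\}^n$ satisfying both satisfies it); its length is $L$. "Asymptotically almost surely" means with probability $1-o(1)$ as $n\to\infty$. *)

theory Defs
  imports Complex_Main
begin

(* Vertices of the block graph: (i, v) with block i < k and index v < n.
   Variables of the CNF: (i, a) with i < k and a < m = log2 n. *)

type_synonym var = "nat \<times> nat"
type_synonym ineq = "(var \<Rightarrow> real) \<times> real"   (* (d, c) encodes  d . x \<ge> c *)

definition vars :: "nat \<Rightarrow> nat \<Rightarrow> var set" where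
  "vars k m = {..<k} \<times> {..<m}"

(* a-th bit of the binary representation of v (a fixed bijection {0..<2^m} <-> {0,1}^m) *)
definition binbit :: "nat \<Rightarrow> nat \<Rightarrow> nat" where
  "binbit v a = (v div 2 ^ a) mod 2"

definition cross_pairs :: "nat \<Rightarrow> nat \<Rightarrow> (nat \<times> nat) set set" where
  "cross_pairs k n = {{(i, v), (j, w)} | i v j w. i < k \<and> j < k \<and> v < n \<and> w < n \<and> i \<noteq> j}"

definition gnpk_prob :: "nat \<Rightarrow> real \<Rightarrow> nat \<Rightarrow> ((nat \<times> nat) set set \<Rightarrow> bool) \<Rightarrow> real" where
  "gnpk_prob n p k P =
     (\<Sum>E \<in> {E. E \<subseteq> cross_pairs k n \<and> P E}.
        p ^ card E * (1 - p) ^ (card (cross_pairs k n) - card E))"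

(* a clause  \<Or>_{v\<in>I} x_v \<or> \<Or>_{v\<in>J} \<not>x_v  given as (I, J) *)
type_synonym clause = "var set \<times> var set"

(* translation of a clause into  \<Sum>_{I} x + \<Sum>_{J} (1 - x) \<ge> 1,  i.e.  d . x \<ge> 1 - |J| *)
definition clause_ineq :: "clause \<Rightarrow> ineq" where
  "clause_ineq C = ((\<lambda>u. (if u \<in> fst C then 1 else 0) - (if u \<in> snd C then 1 else 0)),
                    1 - real (card (snd C)))"

(* literals (x_{i,a} \<noteq> v_a): positive literal x_{i,a} if v_a = 0, negative if v_a = 1 *)
definition block_clause :: "nat \<Rightarrow> nat \<Rightarrow> nat \<Rightarrow> nat \<Rightarrow> nat \<Rightarrow> clause" where
  "block_clause m i v j w =
     ({(i, a) | a. a < m \<and> binbit v a = 0} \<union> {(j, a) | a. a < m \<and> binbit w a = 0},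
      {(i, a) | a. a < m \<and> binbit v a = 1} \<union> {(j, a) | a. a < m \<and> binbit w a = 1})"

definition binclique_block :: "nat \<Rightarrow> nat \<Rightarrow> (nat \<times> nat) set set \<Rightarrow> clause set" where
  "binclique_block m k E =
     {block_clause m i v j w | i v j w. i < k \<and> j < k \<and> i \<noteq> j \<and> v < 2 ^ m \<and> w < 2 ^ m
                                    \<and> {(i, v), (j, w)} \<notin> E}"

definition lin_system :: "nat \<Rightarrow> nat \<Rightarrow> clause set \<Rightarrow> ineq set" where
  "lin_system k m F =
     {((\<lambda>u. if u = v then 1 else 0), 0) | v. v \<in> vars k m}
   \<union> {((\<lambda>u. if u = v then -1 else 0), -1) | v. v \<in> vars k m}
   \<union> clause_ineq ` F"

definition cube :: "nat \<Rightarrow> nat \<Rightarrow> (var \<Rightarrow> real) set" where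
  "cube k m = {x. (\<forall>u \<in> vars k m. x u \<in> {0, 1}) \<and> (\<forall>u. u \<notin> vars k m \<longrightarrow> x u = 0)}"

definition sat_ineq :: "nat \<Rightarrow> nat \<Rightarrow> ineq \<Rightarrow> (var \<Rightarrow> real) \<Rightarrow> bool" where
  "sat_ineq k m l x \<longleftrightarrow> (\<Sum>u \<in> vars k m. fst l u * x u) \<ge> snd l"

definition sem_cp_refutation :: "nat \<Rightarrow> nat \<Rightarrow> ineq set \<Rightarrow> ineq list \<Rightarrow> bool" where
  "sem_cp_refutation k m S R \<longleftrightarrow>
     R \<noteq> [] \<and>
     (\<forall>l \<in> set R. \<forall>u. u \<notin> vars k m \<longrightarrow> fst l u = 0) \<and>
     last R = ((\<lambda>_. 0), 1) \<and>
     (\<forall>t < length R. R ! t \<in> S \<or>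
        (\<exists>j1 < t. \<exists>j2 < t. \<forall>x \<in> cube k m.
            sat_ineq k m (R ! j1) x \<and> sat_ineq k m (R ! j2) x \<longrightarrow> sat_ineq k m (R ! t) x))"

(* min(1/sqrt(1-p), n^(1/4)/log(kn)), where 1/sqrt(1-p) = +infinity for p = 1 *)
definition cp_bound :: "nat \<Rightarrow> nat \<Rightarrow> real \<Rightarrow> real" where
  "cp_bound n k p =
     (if p = 1 then real n powr (1/4) / ln (real (k * n))
      else min (1 / sqrt (1 - p)) (real n powr (1/4) / ln (real (k * n))))"

end

theory Submission
  imports Defs "HOL-Library.FuncSet"
begin

text \<open>
  Split the bits of every block into a low half (Alice) and a high half (Bob). The assignments
  falsifying a line of a refutation then form a triangle \<open>a x < b y\<close>, and the triangle of a derived line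
  is covered by those of its two premises. With each line one keeps, for all but few \<open>x\<close> and \<open>y\<close>, small
  sets of blocks \<open>U x\<close> and \<open>V y\<close> such that every pair in the triangle chooses two nonadjacent vertices
  in blocks of \<open>U x \<inter> V y\<close>. At a derived line the union of the two inherited sets has this property and
  is then made small again: \<open>y\<close> meets the \<open>x\<close> in the order of increasing \<open>a x\<close> and adds two blocks
  only when its current set fails. If every vertex is nonadjacent to at most a \<open>\<delta>\<close>-fraction of any
  half-block, a step has probability \<open>O(d\<^sup>2 \<delta>)\<close> for a random \<open>y\<close>, so more than \<open>d\<close> steps are exponentially
  rare. The last line, falsified by everything, cannot be certified in this way unless the
  accumulated errors are large, that is, unless the refutation is long. A Chernoff bound gives
  \<open>\<delta> = O(1 - p + ln (k n) / sqrt n)\<close> with high probability, and \<open>d\<close> is chosen of order \<open>1 / sqrt \<delta>\<close>.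
\<close>

section \<open>Pruning certificates\<close>

text \<open>The law of total probability for counting measure: a density bound that holds on each
  fibre of \<open>h\<close> holds overall. Probabilities over random assignments are expressed by
  such counts throughout.\<close>

lemma card_le_fibrewise:
  fixes c :: real
  assumes fin: "finite C" and sub: "S \<subseteq> C"
    and le: "\<And>z. z \<in> C \<Longrightarrow> real (card {y\<in>S. h y = h z}) \<le> c * card {y\<in>C. h y = h z}"
  shows "real (card S) \<le> c * card C"
proof -
  have finS: "finite S" using fin sub by (rule rev_finite_subset)
  have S: "card S = (\<Sum>v\<in>h ` C. card {y\<in>S. h y = v})"
    using sum.group[of S "h ` C" h "\<lambda>_. 1::nat"] fin finS image_mono[OF sub, of h] by simp
  have C: "card C = (\<Sum>v\<in>h ` C. card {y\<in>C. h y = v})"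
    using sum.group[of C "h ` C" h "\<lambda>_. 1::nat"] fin by auto
  have "real (card S) = (\<Sum>v\<in>h ` C. real (card {y\<in>S. h y = v}))"
    by (subst S) simp
  also have "\<dots> \<le> (\<Sum>v\<in>h ` C. c * card {y\<in>C. h y = v})"
    by (rule sum_mono) (use le in auto)
  also have "\<dots> = c * card C"
    by (simp add: C flip: sum_distrib_left)
  finally show ?thesis .
qed

text \<open>A uniform element of this set is a random \<open>y\<close> conditioned on its
  coordinates in \<open>I\<close>; \<open>z\<close> enters only through its values on
  \<open>I\<close>.\<close>

definition cylinder :: "'i set \<Rightarrow> 'b set \<Rightarrow> 'i set \<Rightarrow> ('i \<Rightarrow> 'b) \<Rightarrow> ('i \<Rightarrow> 'b) set" where
  "cylinder K B I z = {y \<in> PiE K (\<lambda>_. B). \<forall>i\<in>I. y i = z i}"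

lemma finite_cylinder: "finite K \<Longrightarrow> finite B \<Longrightarrow> finite (cylinder K B I z)"
  unfolding cylinder_def by (intro finite_subset[OF _ finite_PiE[of K "\<lambda>_. B"]]) auto

text \<open>In the application \<open>q i j b b'\<close> says that the vertices with halves
  \<open>b\<close> and \<open>b'\<close> in blocks \<open>i\<close> and \<open>j\<close> are
  nonadjacent, their other halves being frozen. A clash is then a local reason why the chosen
  vertices form no clique.\<close>

definition clash :: "('i \<Rightarrow> 'i \<Rightarrow> 'b \<Rightarrow> 'b \<Rightarrow> bool) \<Rightarrow> 'i set \<Rightarrow> ('i \<Rightarrow> 'b) \<Rightarrow> bool" where
  "clash q I y \<longleftrightarrow> (\<exists>i\<in>I. \<exists>j\<in>I. i \<noteq> j \<and> q i j (y i) (y j))"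

lemma clash_mono: "clash q I y \<Longrightarrow> I \<subseteq> J \<Longrightarrow> clash q J y"
  unfolding clash_def by blast

lemma clash_cong: "(\<And>i. i \<in> I \<Longrightarrow> y i = z i) \<Longrightarrow> clash q I y \<longleftrightarrow> clash q I z"
  unfolding clash_def by auto

text \<open>Symmetry allows the degree bound to be applied to whichever of the two coordinates is
  still random.\<close>

definition sparse :: "'i set \<Rightarrow> 'b set \<Rightarrow> real \<Rightarrow> ('i \<Rightarrow> 'i \<Rightarrow> 'b \<Rightarrow> 'b \<Rightarrow> bool) \<Rightarrow> bool" where
  "sparse K B \<delta> q \<longleftrightarrow>
     (\<forall>i j b b'. q i j b b' = q j i b' b) \<and>
     (\<forall>i\<in>K. \<forall>j\<in>K. \<forall>b\<in>B. i \<noteq> j \<longrightarrow> real (card {b'\<in>B. q i j b b'}) \<le> \<delta> * card B)"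

text \<open>Conditioned on all coordinates except \<open>j\<close>, the value \<open>y j\<close> is
  uniform on \<open>B\<close> because \<open>j\<close> lies outside \<open>I\<close>; the degree
  bound for the fixed value \<open>y i\<close> then applies.\<close>

lemma sparse_card_free:
  assumes "finite K" "finite B" "i \<in> K" "j \<in> K" "i \<noteq> j" "j \<notin> I" "sparse K B \<delta> q"
  shows "real (card {y \<in> cylinder K B I z. q i j (y i) (y j)}) \<le> \<delta> * card (cylinder K B I z)"
proof (rule card_le_fibrewise[where h = "\<lambda>y. y(j := undefined)"])
  show "finite (cylinder K B I z)" using assms by (intro finite_cylinder)
  show "{y \<in> cylinder K B I z. q i j (y i) (y j)} \<subseteq> cylinder K B I z" by auto
next
  fix y1 assume y1: "y1 \<in> cylinder K B I z"
  let ?h = "\<lambda>y. y(j := undefined)"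
  have mem: "y1(j := b) \<in> cylinder K B I z" if "b \<in> B" for b
    using y1 that assms(4,6) unfolding cylinder_def by (auto simp: PiE_iff extensional_def)
  have off: "y l = y1 l" if "?h y = ?h y1" "l \<noteq> j" for y l
    using fun_cong[OF that(1), of l] that(2) by simp
  have rep: "y = y1(j := y j)" if "?h y = ?h y1" for y
    by (rule ext) (use off[OF that] in simp)
  have inj: "inj_on (\<lambda>b. y1(j := b)) T" for T
    by (rule inj_onI) (auto dest: fun_cong[of _ _ j])
  have val: "y j \<in> B" if "y \<in> cylinder K B I z" for y
    using that assms(4) unfolding cylinder_def by auto
  have all: "{y \<in> cylinder K B I z. ?h y = ?h y1} = (\<lambda>b. y1(j := b)) ` B"
  proof (intro equalityI subsetI)
    fix y assume y: "y \<in> {y \<in> cylinder K B I z. ?h y = ?h y1}"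
    show "y \<in> (\<lambda>b. y1(j := b)) ` B"
    proof (rule image_eqI[of _ _ "y j"])
      show "y = y1(j := y j)" using y by (intro rep) simp
      show "y j \<in> B" using y val[of y] by simp
    qed
  qed (use mem in auto)
  have bad: "{y \<in> {y \<in> cylinder K B I z. q i j (y i) (y j)}. ?h y = ?h y1}
      \<subseteq> (\<lambda>b. y1(j := b)) ` {b\<in>B. q i j (y1 i) b}"
  proof
    fix y assume y: "y \<in> {y \<in> {y \<in> cylinder K B I z. q i j (y i) (y j)}. ?h y = ?h y1}"
    then have e: "y i = y1 i" using off[of y i] assms(5) by simp
    show "y \<in> (\<lambda>b. y1(j := b)) ` {b\<in>B. q i j (y1 i) b}"
    proof (rule image_eqI[of _ _ "y j"])
      show "y = y1(j := y j)" using y by (intro rep) simp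
      show "y j \<in> {b\<in>B. q i j (y1 i) b}" using y val[of y] unfolding e[symmetric] by simp
    qed
  qed
  have "y1 i \<in> B" using y1 assms(3) unfolding cylinder_def by auto
  have "real (card {y \<in> {y \<in> cylinder K B I z. q i j (y i) (y j)}. ?h y = ?h y1})
      \<le> card {b\<in>B. q i j (y1 i) b}"
    using card_mono[OF _ bad] card_image[OF inj] assms(2) by (simp only: of_nat_le_iff) simp
  also have "real (card {b\<in>B. q i j (y1 i) b}) \<le> \<delta> * card B"
    using assms \<open>y1 i \<in> B\<close> unfolding sparse_def by auto
  also have "card B = card {y \<in> cylinder K B I z. ?h y = ?h y1}"
    unfolding all by (simp add: card_image[OF inj])
  finally show "real (card {y \<in> {y \<in> cylinder K B I z. q i j (y i) (y j)}. ?h y = ?h y1})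
     \<le> \<delta> * card {y \<in> cylinder K B I z. ?h y = ?h y1}" .
qed

lemma sparse_card:
  assumes "finite K" "finite B" "i \<in> K" "j \<in> K" "i \<noteq> j" "\<not> (i \<in> I \<and> j \<in> I)" and q: "sparse K B \<delta> q"
  shows "real (card {y \<in> cylinder K B I z. q i j (y i) (y j)}) \<le> \<delta> * card (cylinder K B I z)"
proof (cases "j \<in> I")
  case True
  have "q i j = (\<lambda>b b'. q j i b' b)" using q unfolding sparse_def by (intro ext) blast
  then have "{y \<in> cylinder K B I z. q i j (y i) (y j)} = {y \<in> cylinder K B I z. q j i (y j) (y i)}"
    by simp
  moreover have "i \<notin> I" using True assms(6) by simp
  ultimately show ?thesis
    using sparse_card_free[OF assms(1,2,4,3) assms(5)[symmetric] _ q, of I z] by (simp only:) simp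
next
  case False
  show ?thesis by (rule sparse_card_free[OF assms(1-5) False q])
qed

section \<open>The greedy hitting process\<close>

definition clash_pair :: "('i \<Rightarrow> 'i \<Rightarrow> 'b \<Rightarrow> 'b \<Rightarrow> bool) \<Rightarrow> 'i set \<Rightarrow> ('i \<Rightarrow> 'b) \<Rightarrow> 'i \<times> 'i" where
  "clash_pair q I y = (SOME (i, j). i \<in> I \<and> j \<in> I \<and> i \<noteq> j \<and> q i j (y i) (y j))"

lemma clash_pair:
  assumes "clash q I y"
  obtains i j where "clash_pair q I y = (i, j)" "i \<in> I" "j \<in> I" "i \<noteq> j" "q i j (y i) (y j)"
proof -
  have "\<exists>u. case u of (i, j) \<Rightarrow> i \<in> I \<and> j \<in> I \<and> i \<noteq> j \<and> q i j (y i) (y j)"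
    using assms unfolding clash_def by auto
  from someI_ex[OF this] show ?thesis
    using that unfolding clash_pair_def[symmetric] by (cases "clash_pair q I y") auto
qed

text \<open>
  The greedy process for a fixed \<open>y\<close>, where \<open>I\<close> is the current set of blocks. It stops at the first \<open>x\<close>
  that does not clash with \<open>y\<close> at all: in the application such an \<open>x\<close> lies beyond the threshold of \<open>y\<close>,
  and without stopping the \<open>y\<close> that skip \<open>x\<close> would be counted again in \<open>hit_set_card\<close>.
\<close>
fun hit_set :: "('x \<Rightarrow> 'i \<Rightarrow> 'i \<Rightarrow> 'b \<Rightarrow> 'b \<Rightarrow> bool) \<Rightarrow> ('x \<Rightarrow> 'i set) \<Rightarrow> ('i \<Rightarrow> 'b) \<Rightarrow> 'i set
    \<Rightarrow> 'x list \<Rightarrow> 'i set" where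
  "hit_set Q A y I [] = I"
| "hit_set Q A y I (x # xs) =
     (if clash (Q x) (A x \<inter> I) y then hit_set Q A y I xs
      else if clash (Q x) (A x) y
        then (case clash_pair (Q x) (A x) y of (i, j) \<Rightarrow> hit_set Q A y (insert i (insert j I)) xs)
      else I)"

lemma hit_set_incr: "I \<subseteq> hit_set Q A y I xs"
proof (induction xs arbitrary: I)
  case (Cons x xs)
  have "I \<subseteq> hit_set Q A y (insert i (insert j I)) xs" for i j
    using Cons.IH[of "insert i (insert j I)"] by blast
  then show ?case using Cons.IH[of I] by (simp split: prod.splits)
qed simp

lemma hit_set_subset: "I \<subseteq> K \<Longrightarrow> (\<And>x. x \<in> set xs \<Longrightarrow> A x \<subseteq> K) \<Longrightarrow> hit_set Q A y I xs \<subseteq> K"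
proof (induction xs arbitrary: I)
  case (Cons x xs)
  show ?case
  proof (cases "clash (Q x) (A x \<inter> I) y \<or> \<not> clash (Q x) (A x) y")
    case True then show ?thesis using Cons by auto
  next
    case False
    then obtain i j where "clash_pair (Q x) (A x) y = (i, j)" "i \<in> A x" "j \<in> A x"
      using clash_pair by metis
    moreover have "hit_set Q A y (insert i (insert j I)) xs \<subseteq> K"
      using Cons.prems calculation by (intro Cons.IH) auto
    ultimately show ?thesis using False by auto
  qed
qed auto

text \<open>Because \<open>xs\<close> is sorted, every element before \<open>x\<close> is also below
  the threshold and clashes with \<open>y\<close>, so the process does not stop before
  \<open>x\<close>. Once \<open>x\<close> is handled, its clash lies in the current set, which only
  grows afterwards.\<close>

lemma hit_set_clash:
  fixes f :: "'x \<Rightarrow> real"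
  assumes "sorted (map f xs)" and "\<And>x. x \<in> set xs \<Longrightarrow> f x < \<theta> \<Longrightarrow> clash (Q x) (A x) y"
    and "x \<in> set xs" "f x < \<theta>"
  shows "clash (Q x) (A x \<inter> hit_set Q A y I xs) y"
  using assms
proof (induction xs arbitrary: I)
  case (Cons x0 xs)
  have x0: "f x0 < \<theta>" using Cons.prems by fastforce
  then have cl: "clash (Q x0) (A x0) y" using Cons.prems by simp
  then obtain i j where ij: "clash_pair (Q x0) (A x0) y = (i, j)" "i \<in> A x0" "j \<in> A x0" "i \<noteq> j"
    "Q x0 i j (y i) (y j)"
    using clash_pair by metis
  define I' where "I' = (if clash (Q x0) (A x0 \<inter> I) y then I else insert i (insert j I))"
  have hs: "hit_set Q A y I (x0 # xs) = hit_set Q A y I' xs"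
    using cl ij I'_def by auto
  have "clash (Q x0) (A x0 \<inter> I') y"
    using ij unfolding I'_def clash_def by auto
  then have "clash (Q x0) (A x0 \<inter> hit_set Q A y I' xs) y"
    by (rule clash_mono) (use hit_set_incr[of I' Q A y xs] in auto)
  moreover have "clash (Q x) (A x \<inter> hit_set Q A y I' xs) y" if "x \<in> set xs"
    using Cons.prems that by (intro Cons.IH) auto
  ultimately show ?case using Cons.prems(3) hs by auto
qed auto

text \<open>The counted event is a size above card I + 2(d - 1), written without subtraction; it
  forces at least \<open>d\<close> growth steps, as each adds at most two blocks. A step exhibits
  one of at most s^2 pairs of blocks of \<open>A x\<close> that is related although not both
  coordinates were known, which costs a factor \<delta>. Conditioning on the two new coordinates
  leaves the same situation with d - 1, so the induction keeps \<open>I\<close>, \<open>z\<close>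
  and \<open>d\<close> general.\<close>

lemma hit_set_card:
  fixes \<delta> :: real
  assumes K: "finite K" and B: "finite B" and \<delta>: "0 \<le> \<delta>" and "I \<subseteq> K"
    and xs: "\<And>x. x \<in> set xs \<Longrightarrow> A x \<subseteq> K \<and> card (A x) \<le> s \<and> sparse K B \<delta> (Q x)"
  shows "real (card {y \<in> cylinder K B I z. card (hit_set Q A y I xs) + 2 > card I + 2 * d})
    \<le> (real s ^ 2 * \<delta>) ^ d * card (cylinder K B I z)"
  using assms(4-)
proof (induction xs arbitrary: I z d)
  case Nil
  show ?case by (cases d) (auto intro!: zero_le_power mult_nonneg_nonneg \<delta>)
next
  case (Cons x xs)
  define \<rho> where "\<rho> = real s ^ 2 * \<delta>"
  have \<rho>: "\<rho> \<ge> 0" using \<delta> by (simp add: \<rho>_def)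
  have finI: "finite I" using Cons.prems K finite_subset by blast
  have finC: "finite (cylinder K B I z)" by (rule finite_cylinder[OF K B])
  \<comment> \<open>The first test of the process looks only at coordinates in \<open>I\<close>, so
    it has the same outcome for all \<open>y\<close> of the cylinder.\<close>
  have clI: "clash (Q x) (A x \<inter> I) y \<longleftrightarrow> clash (Q x) (A x \<inter> I) z" if "y \<in> cylinder K B I z" for y
    by (rule clash_cong) (use that in \<open>auto simp: cylinder_def\<close>)
  show ?case
  proof (cases d)
    case 0
    then show ?thesis using finC by (auto intro!: card_mono)
  next
    case (Suc e)
    show ?thesis
    proof (cases "clash (Q x) (A x \<inter> I) z")
      case True
      then have "{y \<in> cylinder K B I z. card (hit_set Q A y I (x # xs)) + 2 > card I + 2 * d}
         = {y \<in> cylinder K B I z. card (hit_set Q A y I xs) + 2 > card I + 2 * d}"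
        using clI by auto
      then show ?thesis using Cons by auto
    next
      case False
      have Ax: "A x \<subseteq> K" "card (A x) \<le> s" "sparse K B \<delta> (Q x)" using Cons.prems by auto
      have finA: "finite (A x)" using Ax(1) K finite_subset by blast
      define J where "J i j = insert i (insert j I)" for i j
      define C where "C i j = {y \<in> cylinder K B I z. Q x i j (y i) (y j)}" for i j
      define S where "S i j = {y \<in> C i j. card (hit_set Q A y (J i j) xs) + 2 > card (J i j) + 2 * e}" for i j
      define P where "P = {(i, j). i \<in> A x \<and> j \<in> A x \<and> i \<noteq> j}"
      have P: "P \<subseteq> A x \<times> A x" unfolding P_def by auto
      then have finP: "finite P" using finA by (meson finite_SigmaI finite_subset)
      have "card P \<le> card (A x) * card (A x)"
        using card_mono[OF _ P] finA by (simp add: card_cartesian_product)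
      also have "\<dots> \<le> s * s" using Ax(2) by (rule mult_mono) (use Ax in auto)
      finally have cardP: "real (card P) \<le> real s ^ 2"
        unfolding power2_eq_square of_nat_mult[symmetric] by (rule of_nat_mono)
      have cover: "{y \<in> cylinder K B I z. card (hit_set Q A y I (x # xs)) + 2 > card I + 2 * d}
        \<subseteq> (\<Union>(i, j)\<in>P. S i j)"
      proof
        fix y assume y: "y \<in> {y \<in> cylinder K B I z. card (hit_set Q A y I (x # xs)) + 2 > card I + 2 * d}"
        have ncl: "\<not> clash (Q x) (A x \<inter> I) y" using y clI False by auto
        \<comment> \<open>Otherwise the process stops here with the set \<open>I\<close> itself,
          which is too small to be counted since \<open>d\<close> is positive.\<close>
        have cl: "clash (Q x) (A x) y"
        proof (rule ccontr)
          assume "\<not> clash (Q x) (A x) y"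
          then show False using ncl y Suc by auto
        qed
        then obtain i j where ij: "clash_pair (Q x) (A x) y = (i, j)" "i \<in> A x" "j \<in> A x" "i \<noteq> j"
          "Q x i j (y i) (y j)"
          using clash_pair by metis
        have "card (J i j) \<le> card I + 2"
          unfolding J_def using finI by (simp add: card_insert_if)
        then have "y \<in> S i j"
          using y ncl cl ij Suc unfolding S_def C_def J_def by auto
        then show "y \<in> (\<Union>(i, j)\<in>P. S i j)" using ij unfolding P_def by blast
      qed
      have bound: "real (card (S i j)) \<le> \<rho> ^ e * (\<delta> * card (cylinder K B I z))" if "(i, j) \<in> P" for i j
      proof -
        have ij: "i \<in> A x" "j \<in> A x" "i \<noteq> j" using that unfolding P_def by auto
        \<comment> \<open>Conditioning on the coordinates in \<open>J i j\<close>: membership in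
          \<open>C i j\<close> depends, within the cylinder, only on these, so the fibre of each of
          its points is a full cylinder and the induction hypothesis applies with starting set
          \<open>J i j\<close>.\<close>
        have "real (card (S i j)) \<le> \<rho> ^ e * card (C i j)"
        proof (rule card_le_fibrewise[where h = "\<lambda>y. restrict y (J i j)"])
          show "finite (C i j)" "S i j \<subseteq> C i j" unfolding C_def S_def using finC by auto
        next
          fix y1 assume y1: "y1 \<in> C i j"
          have eq: "restrict y (J i j) = restrict y1 (J i j) \<longleftrightarrow> (\<forall>l\<in>J i j. y l = y1 l)" for y
          proof
            assume "restrict y (J i j) = restrict y1 (J i j)"
            then show "\<forall>l\<in>J i j. y l = y1 l" by (auto simp: restrict_def fun_eq_iff split: if_splits)
          next
            assume "\<forall>l\<in>J i j. y l = y1 l"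
            then show "restrict y (J i j) = restrict y1 (J i j)" by (intro restrict_ext) simp
          qed
          have c: "{y \<in> C i j. restrict y (J i j) = restrict y1 (J i j)} = cylinder K B (J i j) y1"
            unfolding eq using y1 unfolding C_def cylinder_def J_def by auto
          have "{y \<in> S i j. restrict y (J i j) = restrict y1 (J i j)}
            = {y \<in> cylinder K B (J i j) y1. card (hit_set Q A y (J i j) xs) + 2 > card (J i j) + 2 * e}"
            unfolding c[symmetric] S_def by auto
          moreover have "J i j \<subseteq> K" using Cons.prems(1) Ax(1) ij unfolding J_def by auto
          moreover have "real (card {y \<in> cylinder K B (J i j) y1. card (hit_set Q A y (J i j) xs) + 2 > card (J i j) + 2 * e})
            \<le> \<rho> ^ e * card (cylinder K B (J i j) y1)"
            unfolding \<rho>_def by (rule Cons.IH) (use Cons.prems(2) calculation in auto)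
          ultimately show "real (card {y \<in> S i j. restrict y (J i j) = restrict y1 (J i j)})
            \<le> \<rho> ^ e * card {y \<in> C i j. restrict y (J i j) = restrict y1 (J i j)}"
            unfolding c by (simp only:)
        qed
        also have "\<dots> \<le> \<rho> ^ e * (\<delta> * card (cylinder K B I z))"
        proof (rule mult_left_mono)
          show "real (card (C i j)) \<le> \<delta> * card (cylinder K B I z)"
          \<comment> \<open>If both coordinates were known, a related pair would be a clash inside
            \<open>I\<close>, which this branch excludes; otherwise one of the two is still
            random.\<close>
          proof (cases "i \<in> I \<and> j \<in> I")
            case True
            have "C i j = {}"
            proof (rule ccontr)
              assume "C i j \<noteq> {}"
              then obtain y where "y \<in> cylinder K B I z" "Q x i j (y i) (y j)" unfolding C_def by auto
              then have "clash (Q x) (A x \<inter> I) y" using True ij unfolding clash_def by blast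
              then show False using clI False \<open>y \<in> cylinder K B I z\<close> by simp
            qed
            then show ?thesis using \<delta> by simp
          next
            case nI: False
            show ?thesis unfolding C_def
              by (rule sparse_card[OF K B _ _ \<open>i \<noteq> j\<close> nI Ax(3)]) (use Ax(1) ij in auto)
          qed
        qed (use \<rho> in simp)
        finally show ?thesis .
      qed
      have "real (card {y \<in> cylinder K B I z. card (hit_set Q A y I (x # xs)) + 2 > card I + 2 * d})
         \<le> card (\<Union>(i, j)\<in>P. S i j)"
        using cover finP finC by (intro of_nat_mono card_mono) (auto simp: S_def C_def)
      also have "\<dots> \<le> (\<Sum>u\<in>P. card (case u of (i, j) \<Rightarrow> S i j))"
        using card_UN_le[OF finP] by (simp only: of_nat_le_iff)
      also have "\<dots> \<le> (\<Sum>u\<in>P. \<rho> ^ e * (\<delta> * card (cylinder K B I z)))"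
        unfolding of_nat_sum by (rule sum_mono) (use bound in auto)
      also have "\<dots> = card P * (\<rho> ^ e * (\<delta> * card (cylinder K B I z)))" by simp
      also have "\<dots> \<le> real s ^ 2 * (\<rho> ^ e * (\<delta> * card (cylinder K B I z)))"
        by (rule mult_right_mono[OF cardP]) (use \<rho> \<delta> in simp)
      also have "\<dots> = \<rho> ^ d * card (cylinder K B I z)"
        unfolding Suc by (simp add: \<rho>_def)
      finally show ?thesis unfolding \<rho>_def .
    qed
  qed
qed

text \<open>One ordering of \<open>X\<close> serves all \<open>y\<close>: sorted by
  \<open>f\<close>, the relevant \<open>x\<close> form an initial segment for every threshold
  \<open>g y\<close>. The exceptional set \<open>E\<close> collects the \<open>y\<close> with more
  than 2d blocks, hence with at least d + 1 steps. It is measured in the full product, while clashes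
  are assumed only on \<open>Y\<close>, from which earlier errors may have been removed.\<close>

lemma certificate_pruning:
  fixes f :: "'x \<Rightarrow> real" and g :: "('i \<Rightarrow> 'b) \<Rightarrow> real"
  assumes K: "finite K" and B: "finite B" and \<delta>: "0 \<le> \<delta>" and X: "finite X"
    and Q: "\<forall>x\<in>X. A x \<subseteq> K \<and> card (A x) \<le> s \<and> sparse K B \<delta> (Q x)"
    and clash: "\<forall>x\<in>X. \<forall>y\<in>Y. f x < g y \<longrightarrow> clash (Q x) (A x) y"
  shows "\<exists>J E. E \<subseteq> PiE K (\<lambda>_. B) \<and>
    real (card E) \<le> (real s ^ 2 * \<delta>) ^ Suc d * card (PiE K (\<lambda>_. B)) \<and>
    (\<forall>y. J y \<subseteq> K) \<and> (\<forall>y\<in>PiE K (\<lambda>_. B) - E. card (J y) \<le> 2 * d) \<and>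
    (\<forall>x\<in>X. \<forall>y\<in>Y. f x < g y \<longrightarrow> clash (Q x) (A x \<inter> J y) y)"
proof -
  obtain xs0 where xs0: "set xs0 = X" using finite_list[OF X] by blast
  define xs where "xs = sort_key f xs0"
  have xs: "set xs = X" "sorted (map f xs)" by (simp_all add: xs_def xs0)
  define J where "J y = hit_set Q A y {} xs" for y
  define E where "E = {y \<in> cylinder K B {} undefined. card (J y) + 2 > card ({}::'i set) + 2 * Suc d}"
  have cyl: "cylinder K B {} z = PiE K (\<lambda>_. B)" for z unfolding cylinder_def by simp
  show ?thesis
  proof (intro exI conjI ballI allI impI)
    show "E \<subseteq> PiE K (\<lambda>_. B)" unfolding E_def cyl by auto
    show "real (card E) \<le> (real s ^ 2 * \<delta>) ^ Suc d * card (PiE K (\<lambda>_. B))"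
      unfolding cyl[symmetric, of undefined] E_def J_def
      by (rule hit_set_card[OF K B \<delta>]) (use Q xs in auto)
    show "J y \<subseteq> K" for y unfolding J_def by (rule hit_set_subset) (use Q xs in auto)
    show "card (J y) \<le> 2 * d" if "y \<in> PiE K (\<lambda>_. B) - E" for y
      using that unfolding E_def cyl by auto
    show "clash (Q x) (A x \<inter> J y) y" if "x \<in> X" "y \<in> Y" "f x < g y" for x y
      unfolding J_def
      by (rule hit_set_clash[where f = f and \<theta> = "g y"]) (use clash that xs in auto)
  qed
qed

section \<open>Triangle DAGs\<close>

text \<open>\<open>R i j a b a' b'\<close> is to be read as nonadjacency of the vertex of block
  \<open>i\<close> with halves \<open>a\<close>, \<open>b\<close> and the vertex of block
  \<open>j\<close> with halves \<open>a'\<close>, \<open>b'\<close>. Freezing one player's halves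
  leaves a relation of the kind that \<open>sparse\<close> and \<open>clash\<close> speak
  about.\<close>

definition bob_view :: "('i \<Rightarrow> 'i \<Rightarrow> 'a \<Rightarrow> 'b \<Rightarrow> 'a \<Rightarrow> 'b \<Rightarrow> bool) \<Rightarrow> ('i \<Rightarrow> 'a)
    \<Rightarrow> 'i \<Rightarrow> 'i \<Rightarrow> 'b \<Rightarrow> 'b \<Rightarrow> bool" where
  "bob_view R x = (\<lambda>i j b b'. R i j (x i) b (x j) b')"

definition alice_view :: "('i \<Rightarrow> 'i \<Rightarrow> 'a \<Rightarrow> 'b \<Rightarrow> 'a \<Rightarrow> 'b \<Rightarrow> bool) \<Rightarrow> ('i \<Rightarrow> 'b)
    \<Rightarrow> 'i \<Rightarrow> 'i \<Rightarrow> 'a \<Rightarrow> 'a \<Rightarrow> bool" where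
  "alice_view R y = (\<lambda>i j a a'. R i j a (y i) a' (y j))"

lemma clash_alice_bob: "clash (alice_view R y) I x \<longleftrightarrow> clash (bob_view R x) I y"
  unfolding clash_def alice_view_def bob_view_def ..

text \<open>A clash inside the intersection is in particular one inside \<open>U x\<close> alone,
  which is all that a derived line takes from its premises.\<close>

definition certifies where
  "certifies R K s a b X Y U V \<longleftrightarrow>
     (\<forall>x\<in>X. U x \<subseteq> K \<and> card (U x) \<le> s) \<and> (\<forall>y\<in>Y. V y \<subseteq> K \<and> card (V y) \<le> s) \<and>
     (\<forall>x\<in>X. \<forall>y\<in>Y. (a x :: real) < b y \<longrightarrow> clash (bob_view R x) (U x \<inter> V y) y)"

lemma certifiesD:
  assumes "certifies R K s a b X Y U V"
  shows "x \<in> X \<Longrightarrow> U x \<subseteq> K" "x \<in> X \<Longrightarrow> card (U x) \<le> s"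
    "y \<in> Y \<Longrightarrow> V y \<subseteq> K" "y \<in> Y \<Longrightarrow> card (V y) \<le> s"
    "x \<in> X \<Longrightarrow> y \<in> Y \<Longrightarrow> a x < b y \<Longrightarrow> clash (bob_view R x) (U x \<inter> V y) y"
  using assms unfolding certifies_def by simp_all

lemma certifies_antimono:
  assumes "certifies R K s a b X Y U V" "X' \<subseteq> X" "Y' \<subseteq> Y"
  shows "certifies R K s a b X' Y' U V"
  unfolding certifies_def
  by (intro conjI ballI impI certifiesD[OF assms(1)]) (use assms(2,3) in auto)

text \<open>Induction over the lines. At a derived line Alice's sets of the two premises are united,
  to size at most 4d. Pruning against them creates Bob's sets of size 2d, and pruning against those
  brings Alice's sets back to 2d. Each line thus adds at most an \<epsilon>-fraction of errors on
  either side.\<close>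

lemma triangle_certification:
  fixes a :: "nat \<Rightarrow> ('i \<Rightarrow> 'a) \<Rightarrow> real" and b :: "nat \<Rightarrow> ('i \<Rightarrow> 'b) \<Rightarrow> real"
    and \<epsilon> \<delta> :: real and L n :: nat
  assumes K: "finite K" and A: "finite A" and B: "finite B" and \<delta>: "0 \<le> \<delta>" and d: "d \<ge> 1"
    and X: "X = PiE K (\<lambda>_. A)" and Y: "Y = PiE K (\<lambda>_. B)"
    and spB: "\<forall>x\<in>X. sparse K B \<delta> (bob_view R x)"
    and spA: "\<forall>y\<in>Y. sparse K A \<delta> (alice_view R y)"
    and lines: "\<forall>t<L.
      (\<forall>x\<in>X. \<forall>y\<in>Y. \<not> a t x < b t y) \<or>
      (\<exists>i\<in>K. \<exists>j\<in>K. i \<noteq> j \<and> (\<forall>x\<in>X. \<forall>y\<in>Y. a t x < b t y \<longrightarrow> R i j (x i) (y i) (x j) (y j))) \<or>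
      (\<exists>j1<t. \<exists>j2<t. \<forall>x\<in>X. \<forall>y\<in>Y. a t x < b t y \<longrightarrow> a j1 x < b j1 y \<or> a j2 x < b j2 y)"
    and \<epsilon>: "\<epsilon> = (real (4 * d) ^ 2 * \<delta>) ^ Suc d"
    and "n \<le> L"
  shows "\<exists>EA EB U V. EA \<subseteq> X \<and> EB \<subseteq> Y \<and> real (card EA) \<le> n * \<epsilon> * card X \<and> real (card EB) \<le> n * \<epsilon> * card Y \<and>
    (\<forall>t<n. certifies R K (2 * d) (a t) (b t) (X - EA) (Y - EB) (U t) (V t))"
  using \<open>n \<le> L\<close>
proof (induction n)
  case 0
  show ?case by (rule exI[of _ "{}"], rule exI[of _ "{}"]) simp
next
  case (Suc n)
  have finX: "finite X" and finY: "finite Y" using K A B by (simp_all add: X Y finite_PiE)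
  have \<epsilon>0: "\<epsilon> \<ge> 0" using \<delta> by (simp add: \<epsilon>)
  from Suc.prems have "n \<le> L" by simp
  from Suc.IH[OF this] obtain EA EB U V where E: "EA \<subseteq> X" "EB \<subseteq> Y" "real (card EA) \<le> n * \<epsilon> * card X"
      "real (card EB) \<le> n * \<epsilon> * card Y"
    and inv: "\<forall>t<n. certifies R K (2 * d) (a t) (b t) (X - EA) (Y - EB) (U t) (V t)"
    by (elim exE conjE) (rule that)
  note inv = inv[rule_format]
  have "\<exists>EA' EB' u v. EA' \<subseteq> X \<and> EB' \<subseteq> Y \<and> real (card EA') \<le> \<epsilon> * card X \<and> real (card EB') \<le> \<epsilon> * card Y \<and>
    certifies R K (2 * d) (a n) (b n) (X - EA - EA') (Y - EB - EB') u v"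
  proof -
    consider (triv) "\<forall>x\<in>X. \<forall>y\<in>Y. \<not> a n x < b n y"
      | (leaf) i j where "i \<in> K" "j \<in> K" "i \<noteq> j"
          "\<forall>x\<in>X. \<forall>y\<in>Y. a n x < b n y \<longrightarrow> R i j (x i) (y i) (x j) (y j)"
      | (derived) j1 j2 where "j1 < n" "j2 < n"
          "\<forall>x\<in>X. \<forall>y\<in>Y. a n x < b n y \<longrightarrow> a j1 x < b j1 y \<or> a j2 x < b j2 y"
    proof -
      from Suc.prems have "n < L" by simp
      from lines[rule_format, OF this] show thesis
        using triv leaf derived by (elim disjE bexE exE conjE) assumption+
    qed
    then show ?thesis
    proof cases
      case triv
      then show ?thesis using \<epsilon>0
        by (intro exI[of _ "{}"] exI[of _ "\<lambda>_. {}"]) (auto simp: certifies_def)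
    next
      case leaf
      then have "clash (bob_view R x) ({i, j} \<inter> {i, j}) y" if "x \<in> X" "y \<in> Y" "a n x < b n y" for x y
        using that unfolding clash_def bob_view_def by blast
      then show ?thesis using \<epsilon>0 leaf d
        by (intro exI[of _ "{}"] exI[of _ "\<lambda>_. {i, j}"]) (auto simp: certifies_def)
    next
      case derived
      define u' where "u' x = U j1 x \<union> U j2 x" for x
      have u': "\<forall>x\<in>X - EA. u' x \<subseteq> K \<and> card (u' x) \<le> 4 * d \<and> sparse K B \<delta> (bob_view R x)"
      proof
        fix x assume x: "x \<in> X - EA"
        show "u' x \<subseteq> K \<and> card (u' x) \<le> 4 * d \<and> sparse K B \<delta> (bob_view R x)"
          using certifiesD(1,2)[OF inv[OF derived(1)] x] certifiesD(1,2)[OF inv[OF derived(2)] x]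
            card_Un_le[of "U j1 x" "U j2 x"] spB x
          unfolding u'_def by auto
      qed
      have cl: "\<forall>x\<in>X - EA. \<forall>y\<in>Y - EB. a n x < b n y \<longrightarrow> clash (bob_view R x) (u' x) y"
      proof (intro ballI impI)
        fix x y assume xy: "x \<in> X - EA" "y \<in> Y - EB" "a n x < b n y"
        then have "a j1 x < b j1 y \<or> a j2 x < b j2 y" using derived(3) by blast
        then show "clash (bob_view R x) (u' x) y"
        proof
          assume "a j1 x < b j1 y"
          from clash_mono[OF certifiesD(5)[OF inv[OF derived(1)] xy(1,2) this]] show ?thesis unfolding u'_def by blast
        next
          assume "a j2 x < b j2 y"
          from clash_mono[OF certifiesD(5)[OF inv[OF derived(2)] xy(1,2) this]] show ?thesis unfolding u'_def by blast
        qed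
      qed
      from certificate_pruning[OF K B \<delta> _ u' cl, of d, folded Y \<epsilon>] finX
      obtain v EB' where v: "EB' \<subseteq> Y" "real (card EB') \<le> \<epsilon> * card Y" "\<forall>y. v y \<subseteq> K"
        "\<forall>y\<in>Y - EB'. card (v y) \<le> 2 * d"
        "\<forall>x\<in>X - EA. \<forall>y\<in>Y - EB. a n x < b n y \<longrightarrow> clash (bob_view R x) (u' x \<inter> v y) y"
        by (meson finite_Diff)
      \<comment> \<open>Bob's sets are already of size 2d; the weaker bound 4d gives both prunings
        the same error \<epsilon>.\<close>
      have qA: "\<forall>y\<in>Y - EB - EB'. v y \<subseteq> K \<and> card (v y) \<le> 4 * d \<and> sparse K A \<delta> (alice_view R y)"
      proof
        fix y assume y: "y \<in> Y - EB - EB'"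
        with v(4) have "card (v y) \<le> 2 * d" by blast
        then show "v y \<subseteq> K \<and> card (v y) \<le> 4 * d \<and> sparse K A \<delta> (alice_view R y)"
          using v(3) spA y by simp
      qed
      \<comment> \<open>Negating both thresholds exchanges the players, so the same pruning lemma
        shrinks Alice's sets.\<close>
      have cl': "\<forall>y\<in>Y - EB - EB'. \<forall>x\<in>X - EA. - b n y < - a n x \<longrightarrow> clash (alice_view R y) (v y) x"
      proof (intro ballI impI)
        fix x y assume "y \<in> Y - EB - EB'" "x \<in> X - EA" "- b n y < - a n x"
        then have "clash (bob_view R x) (u' x \<inter> v y) y" using v(5) by simp
        then show "clash (alice_view R y) (v y) x"
          unfolding clash_alice_bob by (rule clash_mono) simp
      qed
      from certificate_pruning[OF K A \<delta> _ qA cl', of d, folded X \<epsilon>] finY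
      obtain u EA' where u: "EA' \<subseteq> X" "real (card EA') \<le> \<epsilon> * card X" "\<forall>x. u x \<subseteq> K"
        "\<forall>x\<in>X - EA'. card (u x) \<le> 2 * d"
        "\<forall>y\<in>Y - EB - EB'. \<forall>x\<in>X - EA. - b n y < - a n x \<longrightarrow> clash (alice_view R y) (v y \<inter> u x) x"
        by (meson finite_Diff)
      show ?thesis
        unfolding certifies_def
      proof (intro exI conjI ballI impI)
        show "clash (bob_view R x) (u x \<inter> v y) y"
          if "x \<in> X - EA - EA'" "y \<in> Y - EB - EB'" "a n x < b n y" for x y
          using u(5) that unfolding clash_alice_bob by (simp add: Int_commute)
      qed (use u v in auto)
    qed
  qed
  then obtain EA' EB' u v where E': "EA' \<subseteq> X" "EB' \<subseteq> Y" "real (card EA') \<le> \<epsilon> * card X"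
      "real (card EB') \<le> \<epsilon> * card Y"
    and uv: "certifies R K (2 * d) (a n) (b n) (X - EA - EA') (Y - EB - EB') u v"
    by blast
  have "real (card (EA \<union> EA')) \<le> real (card EA) + card EA'"
    using card_Un_le[of EA EA'] by linarith
  also have "\<dots> \<le> Suc n * \<epsilon> * card X" using E E' by (simp add: algebra_simps)
  finally have cA: "real (card (EA \<union> EA')) \<le> Suc n * \<epsilon> * card X" .
  have "real (card (EB \<union> EB')) \<le> real (card EB) + card EB'"
    using card_Un_le[of EB EB'] by linarith
  also have "\<dots> \<le> Suc n * \<epsilon> * card Y" using E E' by (simp add: algebra_simps)
  finally have cB: "real (card (EB \<union> EB')) \<le> Suc n * \<epsilon> * card Y" .
  show ?case
  proof (intro exI[of _ "EA \<union> EA'"] exI[of _ "EB \<union> EB'"] exI[of _ "U(n := u)"] exI[of _ "V(n := v)"]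
      conjI allI impI ballI cA cB)
    fix t assume "t < Suc n"
    then consider "t < n" | "t = n" by linarith
    then show "certifies R K (2 * d) (a t) (b t) (X - (EA \<union> EA')) (Y - (EB \<union> EB'))
        ((U(n := u)) t) ((V(n := v)) t)"
    proof cases
      case 1
      have "certifies R K (2 * d) (a t) (b t) (X - (EA \<union> EA')) (Y - (EB \<union> EB')) (U t) (V t)"
        by (rule certifies_antimono[OF inv[OF 1]]) auto
      then show ?thesis using 1 by simp
    next
      case 2
      have "X - EA - EA' = X - (EA \<union> EA')" "Y - EB - EB' = Y - (EB \<union> EB')" by blast+
      then show ?thesis using uv 2 by simp
    qed
  qed (use E E' in auto)
qed

text \<open>If the inequality failed, some \<open>x\<close> would survive all errors. At the root
  every surviving \<open>y\<close> must clash inside the small set \<open>U r x\<close>, but a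
  random \<open>y\<close> does so with probability at most \<rho>, and errors together with such
  \<open>y\<close> do not exhaust \<open>Y\<close>.\<close>

lemma triangle_dag_bound:
  fixes a :: "nat \<Rightarrow> ('i \<Rightarrow> 'a) \<Rightarrow> real" and b :: "nat \<Rightarrow> ('i \<Rightarrow> 'b) \<Rightarrow> real"
    and \<delta> :: real and L r :: nat
  assumes K: "finite K" and A: "finite A" "A \<noteq> {}" and B: "finite B" "B \<noteq> {}" and \<delta>: "0 \<le> \<delta>" and d: "d \<ge> 1"
    and X: "X = PiE K (\<lambda>_. A)" and Y: "Y = PiE K (\<lambda>_. B)"
    and spB: "\<forall>x\<in>X. sparse K B \<delta> (bob_view R x)"
    and spA: "\<forall>y\<in>Y. sparse K A \<delta> (alice_view R y)"
    and lines: "\<forall>t<L.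
      (\<forall>x\<in>X. \<forall>y\<in>Y. \<not> a t x < b t y) \<or>
      (\<exists>i\<in>K. \<exists>j\<in>K. i \<noteq> j \<and> (\<forall>x\<in>X. \<forall>y\<in>Y. a t x < b t y \<longrightarrow> R i j (x i) (y i) (x j) (y j))) \<or>
      (\<exists>j1<t. \<exists>j2<t. \<forall>x\<in>X. \<forall>y\<in>Y. a t x < b t y \<longrightarrow> a j1 x < b j1 y \<or> a j2 x < b j2 y)"
    and root: "r < L" "\<And>x y. x \<in> X \<Longrightarrow> y \<in> Y \<Longrightarrow> a r x < b r y"
  shows "1 \<le> L * (real (4 * d) ^ 2 * \<delta>) ^ Suc d + real (4 * d) ^ 2 * \<delta>"
proof (rule ccontr)
  define \<rho> where "\<rho> = real (4 * d) ^ 2 * \<delta>"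
  define \<epsilon> where "\<epsilon> = \<rho> ^ Suc d"
  assume "\<not> ?thesis"
  then have small: "L * \<epsilon> + \<rho> < 1" by (simp add: \<rho>_def \<epsilon>_def)
  have \<rho>: "\<rho> \<ge> 0" using \<delta> by (simp add: \<rho>_def)
  have finX: "finite X" and finY: "finite Y" using K A B by (simp_all add: X Y finite_PiE)
  have "X \<noteq> {}" "Y \<noteq> {}" using A(2) B(2) by (auto simp: X Y PiE_eq_empty_iff)
  then have posX: "real (card X) > 0" and posY: "real (card Y) > 0"
    using finX finY by (simp_all add: card_gt_0_iff)
  obtain EA EB U V where E: "EA \<subseteq> X" "EB \<subseteq> Y" "real (card EA) \<le> L * \<epsilon> * card X"
      "real (card EB) \<le> L * \<epsilon> * card Y"
    and inv: "\<forall>t<L. certifies R K (2 * d) (a t) (b t) (X - EA) (Y - EB) (U t) (V t)"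
  proof -
    have "\<epsilon> = (real (4 * d) ^ 2 * \<delta>) ^ Suc d" by (simp add: \<epsilon>_def \<rho>_def)
    from triangle_certification[where L = L and n = L, OF K A(1) B(1) \<delta> d X Y spB spA lines this order_refl] show ?thesis
      by (elim exE conjE) (rule that)
  qed
  note cert = certifiesD[OF inv[rule_format, OF root(1)]]
  have "L * \<epsilon> * card X < card X" using small \<rho> posX by simp
  then have "EA \<noteq> X" using E(3) by auto
  then obtain x where x: "x \<in> X - EA" using E(1) by blast
  define Z where "Z = {y \<in> Y. clash (bob_view R x) (U r x) y}"
  \<comment> \<open>A run from the empty set on the single element \<open>x\<close> takes a step
    whenever \<open>y\<close> clashes, so \<open>hit_set_card\<close> with d = 1 supplies the union
    bound over pairs of blocks.\<close>
  have "Z \<subseteq> {y \<in> cylinder K B {} undefined. card (hit_set (bob_view R) (U r) y {} [x]) + 2 > card ({}::'i set) + 2 * 1}"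
  proof
    fix y assume y: "y \<in> Z"
    then have cl: "clash (bob_view R x) (U r x) y" unfolding Z_def by simp
    then obtain i j where "clash_pair (bob_view R x) (U r x) y = (i, j)" using clash_pair by metis
    then have "hit_set (bob_view R) (U r) y {} [x] = {i, j}"
      using cl by (simp add: clash_def)
    then show "y \<in> {y \<in> cylinder K B {} undefined. card (hit_set (bob_view R) (U r) y {} [x]) + 2 > card ({}::'i set) + 2 * 1}"
      using y unfolding Z_def cylinder_def Y by (simp add: card_insert_if)
  qed
  then have "real (card Z) \<le> card {y \<in> cylinder K B {} undefined. card (hit_set (bob_view R) (U r) y {} [x]) + 2 > card ({}::'i set) + 2 * 1}"
    by (intro of_nat_mono card_mono) (simp_all add: finite_cylinder K B)
  also have "\<dots> \<le> \<rho> ^ 1 * card (cylinder K B {} undefined)"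
    unfolding \<rho>_def by (rule hit_set_card[OF K B(1) \<delta>]) (use cert(1,2)[OF x] spB x in auto)
  also have "\<dots> = \<rho> * card Y" by (simp add: cylinder_def Y)
  finally have Z: "real (card Z) \<le> \<rho> * card Y" .
  have "real (card (EB \<union> Z)) \<le> real (card EB) + card Z" using card_Un_le[of EB Z] by linarith
  also have "\<dots> \<le> (L * \<epsilon> + \<rho>) * card Y" using E(4) Z by (simp add: algebra_simps)
  also have "\<dots> < card Y" using small posY by simp
  finally have "EB \<union> Z \<noteq> Y" by auto
  then obtain y where "y \<in> Y - EB" "y \<notin> Z" using E(2) unfolding Z_def by blast
  moreover have "clash (bob_view R x) (U r x) y"
    using cert(5)[OF x \<open>y \<in> Y - EB\<close>] root(2)[of x y] x \<open>y \<in> Y - EB\<close> by (auto intro: clash_mono)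
  ultimately show False unfolding Z_def by simp
qed

section \<open>Cutting planes refutations as triangle DAGs\<close>

lemma add_mult_power_less:
  fixes a b :: nat
  assumes "a < 2 ^ m1" "b < 2 ^ m2"
  shows "a + 2 ^ m1 * b < 2 ^ (m1 + m2)"
proof -
  have "a + 2 ^ m1 * b < 2 ^ m1 * (b + 1)" using assms by simp
  also have "\<dots> \<le> 2 ^ m1 * 2 ^ m2" using assms by (intro mult_left_mono) auto
  finally show ?thesis by (simp add: power_add)
qed

lemma binbit_Suc: "binbit v (Suc a) = binbit (v div 2) a"
  by (simp add: binbit_def div_mult2_eq)

lemma binbit_cases: "binbit v a = 0 \<or> binbit v a = 1"
  unfolding binbit_def by auto

lemma binbit_ext:
  "v < 2 ^ m \<Longrightarrow> w < 2 ^ m \<Longrightarrow> (\<And>a. a < m \<Longrightarrow> binbit v a = binbit w a) \<Longrightarrow> v = w"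
proof (induction m arbitrary: v w)
  case (Suc m)
  have "v div 2 = w div 2"
  proof (rule Suc.IH)
    show "binbit (v div 2) a = binbit (w div 2) a" if "a < m" for a
      using Suc.prems(3)[of "Suc a"] that by (simp add: binbit_Suc)
  qed (use Suc.prems in auto)
  moreover have "v mod 2 = w mod 2"
    using Suc.prems(3)[of 0] by (simp add: binbit_def)
  ultimately show ?case by (metis div_mult_mod_eq)
qed simp

lemma binbit_low:
  assumes "a < m" shows "binbit (x + 2 ^ m * y) a = binbit x a"
proof -
  obtain c where "m = a + Suc c" using less_imp_Suc_add[OF assms] by auto
  then have e: "x + 2 ^ m * y = x + 2 ^ a * (2 * (2 ^ c * y))" by (simp add: power_add)
  have "(x + 2 ^ m * y) div 2 ^ a = x div 2 ^ a + 2 * (2 ^ c * y)" unfolding e by simp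
  then show ?thesis unfolding binbit_def by simp
qed

lemma binbit_high:
  assumes "m \<le> a" "x < 2 ^ m" shows "binbit (x + 2 ^ m * y) a = binbit (2 ^ m * y) a"
proof -
  have "(2::nat) ^ a = 2 ^ m * 2 ^ (a - m)" using assms(1) by (simp flip: power_add)
  then show ?thesis unfolding binbit_def using assms(2) by (simp add: div_mult2_eq)
qed

section \<open>Cube points and falsified clauses\<close>

lemma finite_vars: "finite (vars k m)" by (simp add: vars_def)

text \<open>With \<open>card J\<close> moved to the left, the inequality bounds a sum of nonnegative
  terms from below by 1, and a true literal contributes a term equal to 1.\<close>

lemma sat_clause_ineq:
  assumes z: "z \<in> cube k m" and sub: "I \<subseteq> vars k m" "J \<subseteq> vars k m"
    and u: "(u \<in> I \<and> z u = 1) \<or> (u \<in> J \<and> z u = 0)"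
  shows "sat_ineq k m (clause_ineq (I, J)) z"
proof -
  have fin: "finite I" "finite J" using sub finite_vars finite_subset by blast+
  have z01: "z w = 0 \<or> z w = 1" if "w \<in> vars k m" for w using z that unfolding cube_def by auto
  have "(\<Sum>w\<in>vars k m. fst (clause_ineq (I, J)) w * z w)
      = (\<Sum>w\<in>vars k m. (if w \<in> I then z w else 0) - (if w \<in> J then z w else 0))"
    by (rule sum.cong) (auto simp: clause_ineq_def)
  also have "\<dots> = (\<Sum>w\<in>I. z w) - (\<Sum>w\<in>J. z w)"
    using sub by (simp add: sum_subtractf flip: sum.inter_restrict[OF finite_vars]) (simp add: Int_absorb1)
  also have "\<dots> = (\<Sum>w\<in>I. z w) + (\<Sum>w\<in>J. 1 - z w) - card J"
    by (simp add: sum_subtractf)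
  finally have eq: "(\<Sum>w\<in>vars k m. fst (clause_ineq (I, J)) w * z w)
     = (\<Sum>w\<in>I. z w) + (\<Sum>w\<in>J. 1 - z w) - card J" .
  have nn: "0 \<le> z w" "0 \<le> 1 - z w" if "w \<in> vars k m" for w using z01[OF that] by auto
  have nI: "0 \<le> (\<Sum>w\<in>I. z w)" and nJ: "0 \<le> (\<Sum>w\<in>J. 1 - z w)"
    by (intro sum_nonneg; use nn sub in blast)+
  have "1 \<le> (\<Sum>w\<in>I. z w) + (\<Sum>w\<in>J. 1 - z w)"
    using u
  proof
    assume a: "u \<in> I \<and> z u = 1"
    have "z u \<le> (\<Sum>w\<in>I. z w)"
      by (rule member_le_sum) (use a fin nn sub in auto)
    then show ?thesis using a nJ by simp
  next
    assume a: "u \<in> J \<and> z u = 0"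
    have "1 - z u \<le> (\<Sum>w\<in>J. 1 - z w)"
      by (rule member_le_sum[where f = "\<lambda>w. 1 - z w"]) (use a fin nn sub in auto)
    then show ?thesis using a nI by simp
  qed
  then show ?thesis unfolding sat_ineq_def eq by (simp add: clause_ineq_def)
qed

definition point :: "nat \<Rightarrow> nat \<Rightarrow> (nat \<Rightarrow> nat) \<Rightarrow> var \<Rightarrow> real" where
  "point k m v = (\<lambda>u. if u \<in> vars k m then real (binbit (v (fst u)) (snd u)) else 0)"

lemma point_cube: "point k m v \<in> cube k m"
  unfolding cube_def point_def using binbit_cases by auto

lemma sat_bound_ineqs:
  assumes "z \<in> cube k m" "v \<in> vars k m"
  shows "sat_ineq k m ((\<lambda>u. if u = v then 1 else 0), 0) z"
    and "sat_ineq k m ((\<lambda>u. if u = v then -1 else 0), -1) z"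
proof -
  have "z v = 0 \<or> z v = 1" using assms unfolding cube_def by auto
  moreover have "(\<Sum>u\<in>vars k m. (if u = v then c else 0) * z u) = c * z v" for c
    using assms(2) finite_vars by (simp add: if_distrib[of "\<lambda>t. t * _"] cong: if_cong)
  ultimately show "sat_ineq k m ((\<lambda>u. if u = v then 1 else 0), 0) z"
    "sat_ineq k m ((\<lambda>u. if u = v then -1 else 0), -1) z"
    unfolding sat_ineq_def by auto
qed

text \<open>Falsifying the clause makes all its literals false, and these prescribe every bit of
  blocks \<open>i\<close> and \<open>j\<close>.\<close>

lemma block_clause_falsified:
  assumes "i < k" "j < k" "v < 2 ^ m" "w < 2 ^ m" "V i < 2 ^ m" "V j < 2 ^ m"
    and "\<not> sat_ineq k m (clause_ineq (block_clause m i v j w)) (point k m V)"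
  shows "V i = v" "V j = w"
proof -
  define I where "I = {(i, a) | a. a < m \<and> binbit v a = 0} \<union> {(j, a) | a. a < m \<and> binbit w a = 0}"
  define J where "J = {(i, a) | a. a < m \<and> binbit v a = 1} \<union> {(j, a) | a. a < m \<and> binbit w a = 1}"
  have sub: "I \<subseteq> vars k m" "J \<subseteq> vars k m" unfolding I_def J_def vars_def using assms(1,2) by auto
  have unsat: "\<not> ((u \<in> I \<and> point k m V u = 1) \<or> (u \<in> J \<and> point k m V u = 0))" for u
    using sat_clause_ineq[OF point_cube sub] assms(7) unfolding I_def J_def block_clause_def by blast
  have pt: "point k m V (l, a) = binbit (V l) a" if "l < k" "a < m" for l a
    using that by (simp add: point_def vars_def)
  have agree: "binbit (V l) a = binbit w' a"
    if l: "l < k" "a < m" and w': "binbit w' a = 0 \<Longrightarrow> (l, a) \<in> I" "binbit w' a = 1 \<Longrightarrow> (l, a) \<in> J" for l a w'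
    using binbit_cases[of w' a]
  proof
    assume "binbit w' a = 0"
    then show ?thesis using unsat[of "(l, a)"] w'(1) pt[OF l] binbit_cases[of "V l" a] by auto
  next
    assume "binbit w' a = 1"
    then show ?thesis using unsat[of "(l, a)"] w'(2) pt[OF l] binbit_cases[of "V l" a] by auto
  qed
  show "V i = v"
    by (rule binbit_ext[OF assms(5,3)], rule agree) (auto simp: I_def J_def assms)
  show "V j = w"
    by (rule binbit_ext[OF assms(6,4)], rule agree) (auto simp: I_def J_def assms)
qed

text \<open>Writing each vertex as a + 2^m1 b splits the linear form of a line into a part in the
  low bits and a part in the high bits, so falsifying the line is a comparison
  \<open>f t x < g t y\<close>. Variable bounds give empty triangles, clauses give leaves labelled
  by a nonadjacent pair, and \<open>0 \<ge> 1\<close> is falsified everywhere.\<close>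

lemma refutation_length_bound:
  fixes \<delta> :: real and E :: "(nat \<times> nat) set set"
  assumes m: "m = m1 + m2" and \<delta>: "0 \<le> \<delta>" and d: "d \<ge> 1"
    and high: "\<And>i j v a. i < k \<Longrightarrow> j < k \<Longrightarrow> i \<noteq> j \<Longrightarrow> v < 2 ^ m \<Longrightarrow> a < 2 ^ m1 \<Longrightarrow>
      real (card {b \<in> {..<2 ^ m2}. {(i, v), (j, a + 2 ^ m1 * b)} \<notin> E}) \<le> \<delta> * 2 ^ m2"
    and low: "\<And>i j v b. i < k \<Longrightarrow> j < k \<Longrightarrow> i \<noteq> j \<Longrightarrow> v < 2 ^ m \<Longrightarrow> b < 2 ^ m2 \<Longrightarrow>
      real (card {a \<in> {..<2 ^ m1}. {(i, v), (j, a + 2 ^ m1 * b)} \<notin> E}) \<le> \<delta> * 2 ^ m1"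
    and ref: "sem_cp_refutation k m (lin_system k m (binclique_block m k E)) R"
  shows "1 \<le> length R * (real (4 * d) ^ 2 * \<delta>) ^ Suc d + real (4 * d) ^ 2 * \<delta>"
proof -
  define N where "N i j a b a' b' \<longleftrightarrow> {(i, a + 2 ^ m1 * b), (j, a' + 2 ^ m1 * b')} \<notin> E"
    for i j a b a' b' :: nat
  define X where "X = ({..<k} \<rightarrow>\<^sub>E {..<(2::nat) ^ m1})"
  define Y where "Y = ({..<k} \<rightarrow>\<^sub>E {..<(2::nat) ^ m2})"
  define V where "V x y = (\<lambda>i. x i + 2 ^ m1 * y i)" for x y :: "nat \<Rightarrow> nat"
  define f where "f t x = (\<Sum>u\<in>{u\<in>vars k m. snd u < m1}. fst (R ! t) u * real (binbit (x (fst u)) (snd u)))"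
    for t x
  \<comment> \<open>The right-hand side goes to Bob's part. His bits are read off
    \<open>2 ^ m1 * y\<close> alone, since the low half does not affect the high bits.\<close>
  define g where "g t y = snd (R ! t) -
      (\<Sum>u\<in>{u\<in>vars k m. \<not> snd u < m1}. fst (R ! t) u * real (binbit (2 ^ m1 * y (fst u)) (snd u)))"
    for t y
  have join: "a + 2 ^ m1 * b < 2 ^ m" if "a < 2 ^ m1" "b < 2 ^ m2" for a b :: nat
    unfolding m using that by (rule add_mult_power_less)
  have Xi: "x i < 2 ^ m1" if "x \<in> X" "i < k" for x i using that unfolding X_def by auto
  have Yi: "y i < 2 ^ m2" if "y \<in> Y" "i < k" for y i using that unfolding Y_def by auto
  have falsified: "f t x < g t y \<longleftrightarrow> \<not> sat_ineq k m (R ! t) (point k m (V x y))"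
    if "x \<in> X" "y \<in> Y" for t x y
  proof -
    let ?z = "point k m (V x y)"
    have "(\<Sum>u\<in>vars k m. fst (R ! t) u * ?z u)
       = (\<Sum>u\<in>{u\<in>vars k m. snd u < m1}. fst (R ! t) u * ?z u)
        + (\<Sum>u\<in>{u\<in>vars k m. \<not> snd u < m1}. fst (R ! t) u * ?z u)"
      by (subst sum.union_disjoint[symmetric]) (auto simp: finite_vars intro: sum.cong)
    also have "(\<Sum>u\<in>{u\<in>vars k m. snd u < m1}. fst (R ! t) u * ?z u) = f t x"
      unfolding f_def by (rule sum.cong) (auto simp: point_def V_def binbit_low)
    also have "(\<Sum>u\<in>{u\<in>vars k m. \<not> snd u < m1}. fst (R ! t) u * ?z u) = snd (R ! t) - g t y"
      unfolding g_def using Xi[OF that(1)]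
      by (auto simp: point_def V_def vars_def binbit_high intro!: sum.cong)
    finally show ?thesis unfolding sat_ineq_def by auto
  qed
  have refR: "R \<noteq> []" "last R = ((\<lambda>_. 0), 1)"
    "\<And>t. t < length R \<Longrightarrow> R ! t \<in> lin_system k m (binclique_block m k E) \<or>
        (\<exists>j1 < t. \<exists>j2 < t. \<forall>x \<in> cube k m.
            sat_ineq k m (R ! j1) x \<and> sat_ineq k m (R ! j2) x \<longrightarrow> sat_ineq k m (R ! t) x)"
    using ref unfolding sem_cp_refutation_def by blast+
  have lines: "(\<forall>x\<in>X. \<forall>y\<in>Y. \<not> f t x < g t y) \<or>
      (\<exists>i\<in>{..<k}. \<exists>j\<in>{..<k}. i \<noteq> j \<and> (\<forall>x\<in>X. \<forall>y\<in>Y. f t x < g t y \<longrightarrow> N i j (x i) (y i) (x j) (y j))) \<or>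
      (\<exists>j1<t. \<exists>j2<t. \<forall>x\<in>X. \<forall>y\<in>Y. f t x < g t y \<longrightarrow> f j1 x < g j1 y \<or> f j2 x < g j2 y)"
    if t: "t < length R" for t
    using refR(3)[OF t]
  proof
    assume "R ! t \<in> lin_system k m (binclique_block m k E)"
    then consider v where "v \<in> vars k m" "R ! t = ((\<lambda>u. if u = v then 1 else 0), 0)"
      | v where "v \<in> vars k m" "R ! t = ((\<lambda>u. if u = v then -1 else 0), -1)"
      | i v j w where "i < k" "j < k" "i \<noteq> j" "v < 2 ^ m" "w < 2 ^ m" "{(i, v), (j, w)} \<notin> E"
          "R ! t = clause_ineq (block_clause m i v j w)"
      unfolding lin_system_def binclique_block_def by blast
    then show ?thesis
    proof cases
      case 1
      then show ?thesis using sat_bound_ineqs(1)[OF point_cube 1(1)] falsified by simp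
    next
      case 2
      then show ?thesis using sat_bound_ineqs(2)[OF point_cube 2(1)] falsified by simp
    next
      case 3
      have "N i j (x i) (y i) (x j) (y j)" if "x \<in> X" "y \<in> Y" "f t x < g t y" for x y
      proof -
        have "V x y i = v \<and> V x y j = w"
          using block_clause_falsified[OF 3(1,2,4,5), of "V x y"] join Xi Yi 3 that falsified[of x y t]
          unfolding V_def by auto
        then show ?thesis unfolding N_def using 3(6) unfolding V_def by simp
      qed
      then show ?thesis using 3(1-3) by blast
    qed
  next
    assume "\<exists>j1 < t. \<exists>j2 < t. \<forall>x \<in> cube k m.
            sat_ineq k m (R ! j1) x \<and> sat_ineq k m (R ! j2) x \<longrightarrow> sat_ineq k m (R ! t) x"
    \<comment> \<open>Contraposition: a point that falsifies the derived line falsifies one of its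
      premises.\<close>
    then show ?thesis using falsified point_cube by meson
  qed
  have sym: "N i j a b a' b' = N j i a' b' a b" for i j a b a' b'
    unfolding N_def by (simp add: insert_commute)
  have spB: "sparse {..<k} {..<2 ^ m2} \<delta> (bob_view N x)" if "x \<in> X" for x
    unfolding sparse_def bob_view_def
  proof (intro conjI allI ballI impI)
    show "N i j (x i) b (x j) b' = N j i (x j) b' (x i) b" for i j b b' by (rule sym)
    show "real (card {b' \<in> {..<2 ^ m2}. N i j (x i) b (x j) b'}) \<le> \<delta> * card {..<(2::nat) ^ m2}"
      if "i \<in> {..<k}" "j \<in> {..<k}" "b \<in> {..<2 ^ m2}" "i \<noteq> j" for i j b
      using high[of i j "x i + 2 ^ m1 * b" "x j"] that join[of "x i" b] Xi[OF \<open>x \<in> X\<close>] unfolding N_def by simp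
  qed
  have spA: "sparse {..<k} {..<2 ^ m1} \<delta> (alice_view N y)" if "y \<in> Y" for y
    unfolding sparse_def alice_view_def
  proof (intro conjI allI ballI impI)
    show "N i j b (y i) b' (y j) = N j i b' (y j) b (y i)" for i j b b' by (rule sym)
    show "real (card {b' \<in> {..<2 ^ m1}. N i j b (y i) b' (y j)}) \<le> \<delta> * card {..<(2::nat) ^ m1}"
      if "i \<in> {..<k}" "j \<in> {..<k}" "b \<in> {..<2 ^ m1}" "i \<noteq> j" for i j b
      using low[of i j "b + 2 ^ m1 * y i" "y j"] that join[of b "y i"] Yi[OF \<open>y \<in> Y\<close>] unfolding N_def by simp
  qed
  have ne: "{..<(2::nat) ^ l} \<noteq> {}" for l by (auto simp: lessThan_empty_iff)
  have root: "f (length R - 1) x < g (length R - 1) y" if "x \<in> X" "y \<in> Y" for x y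
    unfolding falsified[OF that] using refR(1,2) by (simp add: last_conv_nth sat_ineq_def)
  show ?thesis
    by (rule triangle_dag_bound[where K = "{..<k}" and A = "{..<2 ^ m1}" and B = "{..<2 ^ m2}"
          and X = X and Y = Y and R = N and a = f and b = g and r = "length R - 1", OF _ _ ne _ ne \<delta> d X_def Y_def])
      (use spB spA lines root refR(1) in auto)
qed

section \<open>Nonneighbours in the random block graph\<close>

lemma finite_cross_pairs: "finite (cross_pairs k n)"
proof (rule finite_subset)
  show "cross_pairs k n \<subseteq> (\<lambda>(u, w). {u, w}) ` (({..<k} \<times> {..<n}) \<times> ({..<k} \<times> {..<n}))"
    unfolding cross_pairs_def by force
qed simp

definition gnpk_weight :: "nat \<Rightarrow> real \<Rightarrow> nat \<Rightarrow> (nat \<times> nat) set set \<Rightarrow> real" where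
  "gnpk_weight n p k E = p ^ card E * (1 - p) ^ (card (cross_pairs k n) - card E)"

lemma gnpk_prob_weight:
  "gnpk_prob n p k P = (\<Sum>E \<in> {E. E \<subseteq> cross_pairs k n \<and> P E}. gnpk_weight n p k E)"
  unfolding gnpk_prob_def gnpk_weight_def ..

lemma gnpk_weight_nonneg: "0 \<le> p \<Longrightarrow> p \<le> 1 \<Longrightarrow> 0 \<le> gnpk_weight n p k E"
  unfolding gnpk_weight_def by simp

lemma finite_events: "finite {E. E \<subseteq> cross_pairs k n \<and> P E}"
  by (rule finite_subset[of _ "Pow (cross_pairs k n)"]) (auto simp: finite_cross_pairs)

text \<open>The generating function of the number of missing pairs in \<open>S\<close>. Independence
  makes the sum over graphs factor over pairs, and a pair outside \<open>S\<close> contributes p +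
  (1 - p) = 1.\<close>

lemma gnpk_sum_exp_missing:
  assumes S: "S \<subseteq> cross_pairs k n"
  shows "(\<Sum>E\<in>Pow (cross_pairs k n). gnpk_weight n p k E * c ^ card (S - E)) = (p + (1 - p) * c) ^ card S"
proof -
  let ?U = "cross_pairs k n"
  let ?h = "\<lambda>e. if e \<in> S then c else 1"
  have "gnpk_weight n p k E * c ^ card (S - E) = (\<Prod>e\<in>E. p) * (\<Prod>e\<in>?U - E. (1 - p) * ?h e)"
    if "E \<subseteq> ?U" for E
  proof -
    have "(\<Prod>e\<in>?U - E. ?h e) = c ^ card ((?U - E) \<inter> S)"
      using finite_cross_pairs by (simp flip: prod.inter_restrict)
    also have "(?U - E) \<inter> S = S - E" using S by auto
    finally show ?thesis
      using that finite_cross_pairs finite_subset[OF that]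
      by (simp add: gnpk_weight_def prod.distrib card_Diff_subset)
  qed
  then have "(\<Sum>E\<in>Pow ?U. gnpk_weight n p k E * c ^ card (S - E))
      = (\<Sum>E\<in>Pow ?U. (\<Prod>e\<in>E. p) * (\<Prod>e\<in>?U - E. (1 - p) * ?h e))"
    by (intro sum.cong) auto
  also have "\<dots> = (\<Prod>e\<in>?U. p + (1 - p) * ?h e)"
    by (rule prod_add[OF finite_cross_pairs, symmetric])
  also have "\<dots> = (\<Prod>e\<in>?U. if e \<in> S then p + (1 - p) * c else 1)"
    by (rule prod.cong) auto
  also have "\<dots> = (p + (1 - p) * c) ^ card S"
    using S finite_cross_pairs by (simp add: Int_absorb1 flip: prod.inter_restrict)
  finally show ?thesis .
qed

lemma gnpk_prob_compl: "gnpk_prob n p k P + gnpk_prob n p k (\<lambda>E. \<not> P E) = 1"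
proof -
  have "gnpk_prob n p k P + gnpk_prob n p k (\<lambda>E. \<not> P E)
     = sum (gnpk_weight n p k) ({E. E \<subseteq> cross_pairs k n \<and> P E} \<union> {E. E \<subseteq> cross_pairs k n \<and> \<not> P E})"
    unfolding gnpk_prob_weight by (rule sum.union_disjoint[symmetric]) (auto simp: finite_events)
  also have "{E. E \<subseteq> cross_pairs k n \<and> P E} \<union> {E. E \<subseteq> cross_pairs k n \<and> \<not> P E} = Pow (cross_pairs k n)"
    by auto
  also have "sum (gnpk_weight n p k) \<dots> = 1"
    using gnpk_sum_exp_missing[of "{}" k n p 1] by simp
  finally show ?thesis .
qed

lemma gnpk_prob_nonneg: "0 \<le> p \<Longrightarrow> p \<le> 1 \<Longrightarrow> 0 \<le> gnpk_prob n p k P"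
  unfolding gnpk_prob_weight by (intro sum_nonneg gnpk_weight_nonneg)

lemma gnpk_prob_le_1: "0 \<le> p \<Longrightarrow> p \<le> 1 \<Longrightarrow> gnpk_prob n p k P \<le> 1"
  using gnpk_prob_compl[of n p k P] gnpk_prob_nonneg[of p n k "\<lambda>E. \<not> P E"] by linarith

lemma gnpk_prob_mono:
  assumes "0 \<le> p" "p \<le> 1" "\<And>E. P E \<Longrightarrow> Q E"
  shows "gnpk_prob n p k P \<le> gnpk_prob n p k Q"
  unfolding gnpk_prob_weight
  by (intro sum_mono2 finite_events gnpk_weight_nonneg) (use assms in auto)

lemma gnpk_prob_union_bound:
  fixes c :: real
  assumes p: "0 \<le> p" "p \<le> 1" and I: "finite I" and Q: "\<And>i. i \<in> I \<Longrightarrow> gnpk_prob n p k (Q i) \<le> c"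
  shows "gnpk_prob n p k (\<lambda>E. \<exists>i\<in>I. Q i E) \<le> card I * c"
  using I Q
proof (induction I)
  case empty
  show ?case by (simp add: gnpk_prob_weight)
next
  case (insert i I)
  let ?A = "{E. E \<subseteq> cross_pairs k n \<and> Q i E}"
  let ?B = "{E. E \<subseteq> cross_pairs k n \<and> (\<exists>i\<in>I. Q i E)}"
  have "gnpk_prob n p k (\<lambda>E. \<exists>i\<in>insert i I. Q i E) = sum (gnpk_weight n p k) (?A \<union> ?B)"
    unfolding gnpk_prob_weight by (rule sum.cong) auto
  also have "\<dots> = sum (gnpk_weight n p k) ?A + sum (gnpk_weight n p k) ?B - sum (gnpk_weight n p k) (?A \<inter> ?B)"
    by (rule sum_Un) (rule finite_events)+
  also have "\<dots> \<le> sum (gnpk_weight n p k) ?A + sum (gnpk_weight n p k) ?B"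
    by (simp add: sum_nonneg gnpk_weight_nonneg[OF p])
  also have "\<dots> \<le> c + card I * c"
    using insert.IH insert.prems unfolding gnpk_prob_weight by (intro add_mono) auto
  finally show ?case using insert.hyps by (simp add: algebra_simps)
qed

text \<open>A Chernoff bound: Markov's inequality for exp of the number of missing pairs, with the
  fixed parameter 1 in the exponent.\<close>

lemma gnpk_prob_many_missing:
  assumes p: "0 \<le> p" "p \<le> 1" and S: "S \<subseteq> cross_pairs k n"
  shows "gnpk_prob n p k (\<lambda>E. real (card (S - E)) > 2 * (1 - p) * card S + s) \<le> exp (- s)"
proof -
  define T where "T = 2 * (1 - p) * card S + s"
  let ?w = "gnpk_weight n p k"
  let ?B = "{E. E \<subseteq> cross_pairs k n \<and> real (card (S - E)) > T}"
  have "gnpk_prob n p k (\<lambda>E. real (card (S - E)) > T) \<le> (\<Sum>E\<in>?B. ?w E * (exp 1 ^ card (S - E) * exp (- T)))"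
    unfolding gnpk_prob_weight
  proof (rule sum_mono)
    fix E assume "E \<in> ?B"
    then have "exp 1 ^ card (S - E) * exp (- T) \<ge> 1"
      by (simp flip: exp_of_nat_mult exp_add)
    then show "?w E \<le> ?w E * (exp 1 ^ card (S - E) * exp (- T))"
      using mult_left_mono[OF _ gnpk_weight_nonneg[OF p]] by fastforce
  qed
  also have "\<dots> \<le> (\<Sum>E\<in>Pow (cross_pairs k n). ?w E * (exp 1 ^ card (S - E) * exp (- T)))"
    by (intro sum_mono2) (use finite_cross_pairs gnpk_weight_nonneg[OF p] in auto)
  also have "\<dots> = (\<Sum>E\<in>Pow (cross_pairs k n). ?w E * exp 1 ^ card (S - E)) * exp (- T)"
    unfolding sum_distrib_right by (simp add: mult.assoc)
  also have "\<dots> = (p + (1 - p) * exp 1) ^ card S * exp (- T)"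
    by (simp only: gnpk_sum_exp_missing[OF S])
  also have "\<dots> \<le> exp (2 * (1 - p)) ^ card S * exp (- T)"
  proof (intro mult_right_mono power_mono)
    \<comment> \<open>The estimate e \<le> 3 is the origin of the factor 2 in the threshold.\<close>
    have "p + (1 - p) * exp 1 \<le> p + (1 - p) * 3" using p exp_le by (intro add_left_mono mult_left_mono) auto
    also have "\<dots> = 1 + 2 * (1 - p)" by simp
    also have "\<dots> \<le> exp (2 * (1 - p))" by (rule exp_ge_add_one_self)
    finally show "p + (1 - p) * exp 1 \<le> exp (2 * (1 - p))" .
  qed (use p in auto)
  also have "\<dots> = exp (- s)" unfolding T_def by (simp add: mult_ac flip: exp_of_nat_mult exp_add)
  finally show ?thesis unfolding T_def .
qed

text \<open>Here \<open>f\<close> enumerates a half-block of block \<open>j\<close>; distinct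
  arguments give distinct pairs because i differs from j.\<close>

lemma gnpk_prob_many_nonneighbours:
  fixes H :: nat
  assumes p: "0 \<le> p" "p \<le> 1" and "i < k" "j < k" "i \<noteq> j" "v < n"
    and f: "inj_on f {..<H}" "\<And>b. b < H \<Longrightarrow> f b < n"
  shows "gnpk_prob n p k (\<lambda>E. real (card {b \<in> {..<H}. {(i, v), (j, f b)} \<notin> E}) > 2 * (1 - p) * H + s) \<le> exp (- s)"
proof -
  let ?e = "\<lambda>b. {(i, v), (j, f b)}"
  define S where "S = ?e ` {..<H}"
  have inj: "inj_on ?e {..<H}"
    using f(1) \<open>i \<noteq> j\<close> by (auto simp: inj_on_def doubleton_eq_iff)
  have S: "S \<subseteq> cross_pairs k n" unfolding S_def cross_pairs_def using assms by blast
  have "card {b \<in> {..<H}. ?e b \<notin> E} = card (S - E)" for E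
  proof -
    have "S - E = ?e ` {b \<in> {..<H}. ?e b \<notin> E}" unfolding S_def by auto
    moreover have "inj_on ?e {b \<in> {..<H}. ?e b \<notin> E}" using inj by (rule inj_on_subset) auto
    ultimately show ?thesis by (simp add: card_image)
  qed
  moreover have "card S = H" unfolding S_def by (simp add: card_image[OF inj])
  ultimately show ?thesis using gnpk_prob_many_missing[OF p S, of s] by simp
qed

section \<open>Regularity of all half-blocks\<close>

definition balanced :: "nat \<Rightarrow> nat \<Rightarrow> nat \<Rightarrow> real \<Rightarrow> (nat \<times> nat) set set \<Rightarrow> bool" where
  "balanced m1 m2 k \<delta> E \<longleftrightarrow> (\<forall>i<k. \<forall>j<k. \<forall>v<2 ^ (m1 + m2). i \<noteq> j \<longrightarrow>
     (\<forall>a<2 ^ m1. real (card {b \<in> {..<2 ^ m2}. {(i, v), (j, a + 2 ^ m1 * b)} \<notin> E}) \<le> \<delta> * 2 ^ m2) \<and>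
     (\<forall>b<2 ^ m2. real (card {a \<in> {..<2 ^ m1}. {(i, v), (j, a + 2 ^ m1 * b)} \<notin> E}) \<le> \<delta> * 2 ^ m1))"

text \<open>A union bound over at most 2(kn)^2 events. The slack 4 ln(kn) makes each of them have
  probability at most (kn)^(-4), and n \<le> kn removes \<open>k\<close> from the result.\<close>

lemma gnpk_prob_not_balanced:
  fixes m1 m2 k :: nat and p :: real
  defines "n \<equiv> 2 ^ (m1 + m2)"
  assumes p: "0 \<le> p" "p \<le> 1" and k: "1 \<le> k" and le: "m1 \<le> m2"
    and \<delta>: "\<delta> = 2 * (1 - p) + 4 * ln (real (k * n)) / 2 ^ m1"
  shows "gnpk_prob n p k (\<lambda>E. \<not> balanced m1 m2 k \<delta> E) \<le> 2 / real n ^ 2"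
proof -
  define N where "N = real (k * n)"
  define \<sigma> where "\<sigma> = 4 * ln N"
  have n1: "n \<ge> 1" unfolding n_def by simp
  have Nn: "N \<ge> n" using k n1 unfolding N_def by simp
  have N1: "N \<ge> 1" using Nn n1 by linarith
  have \<sigma>: "\<sigma> \<ge> 0" using N1 by (simp add: \<sigma>_def)
  define I where "I = {(i, j, v, c, s). i < k \<and> j < k \<and> i \<noteq> j \<and> v < n \<and> c < (if s then 2 ^ m1 else (2::nat) ^ m2)}"
  define Q where "Q u E = (case u of (i, j, v, c, s) \<Rightarrow>
      if s then real (card {b \<in> {..<2 ^ m2}. {(i, v), (j, c + 2 ^ m1 * b)} \<notin> E}) > 2 * (1 - p) * real (2 ^ m2) + \<sigma>
      else real (card {a \<in> {..<2 ^ m1}. {(i, v), (j, a + 2 ^ m1 * c)} \<notin> E}) > 2 * (1 - p) * real (2 ^ m1) + \<sigma>)"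
    for u :: "nat \<times> nat \<times> nat \<times> nat \<times> bool" and E :: "(nat \<times> nat) set set"
  have pow_n: "(2::nat) ^ m1 \<le> n" "(2::nat) ^ m2 \<le> n" unfolding n_def by (simp_all add: power_add)
  have Isub: "I \<subseteq> {..<k} \<times> {..<k} \<times> {..<n} \<times> {..<n} \<times> UNIV"
    using pow_n unfolding I_def by (auto split: if_splits)
  have finI: "finite I" by (rule finite_subset[OF Isub]) simp
  have "card I \<le> card ({..<k} \<times> {..<k} \<times> {..<n} \<times> {..<n} \<times> (UNIV :: bool set))"
    by (rule card_mono[OF _ Isub]) simp
  also have "\<dots> = 2 * (k * n) ^ 2" by (simp add: card_cartesian_product power2_eq_square)
  finally have "real (card I) \<le> real (2 * (k * n) ^ 2)" by (rule of_nat_mono)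
  then have cardI: "real (card I) \<le> 2 * N ^ 2" by (simp add: N_def)
  \<comment> \<open>The additive slack is turned into a density; the half-blocks of size 2^m1, the
    smaller ones, are the worst case.\<close>
  have le\<delta>: "2 * (1 - p) * 2 ^ l + \<sigma> \<le> \<delta> * 2 ^ l" if "m1 \<le> l" for l
  proof -
    have "(2::real) ^ m1 \<le> 2 ^ l" using that by simp
    then have "\<sigma> \<le> \<sigma> / 2 ^ m1 * 2 ^ l" using \<sigma> by (simp add: field_simps mult_left_mono)
    then show ?thesis unfolding \<delta> \<sigma>_def N_def by (simp add: algebra_simps)
  qed
  have bad: "\<exists>u\<in>I. Q u E" if "\<not> balanced m1 m2 k \<delta> E" for E
  proof -
    from that obtain i j v where ijv: "i < k" "j < k" "v < n" "i \<noteq> j"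
      and *: "(\<exists>a<2 ^ m1. \<not> real (card {b \<in> {..<2 ^ m2}. {(i, v), (j, a + 2 ^ m1 * b)} \<notin> E}) \<le> \<delta> * 2 ^ m2) \<or>
         (\<exists>b<2 ^ m2. \<not> real (card {a \<in> {..<2 ^ m1}. {(i, v), (j, a + 2 ^ m1 * b)} \<notin> E}) \<le> \<delta> * 2 ^ m1)"
      unfolding balanced_def n_def by blast
    from * show ?thesis
    proof (elim disjE exE conjE)
      fix a :: nat assume a: "a < 2 ^ m1"
        "\<not> real (card {b \<in> {..<2 ^ m2}. {(i, v), (j, a + 2 ^ m1 * b)} \<notin> E}) \<le> \<delta> * 2 ^ m2"
      have "(i, j, v, a, True) \<in> I" using ijv a unfolding I_def by simp
      moreover have "Q (i, j, v, a, True) E" using a(2) le\<delta>[OF le] unfolding Q_def by simp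
      ultimately show ?thesis by blast
    next
      fix b :: nat assume b: "b < 2 ^ m2"
        "\<not> real (card {a \<in> {..<2 ^ m1}. {(i, v), (j, a + 2 ^ m1 * b)} \<notin> E}) \<le> \<delta> * 2 ^ m1"
      have "(i, j, v, b, False) \<in> I" using ijv b unfolding I_def by simp
      moreover have "Q (i, j, v, b, False) E" using b(2) le\<delta>[of m1] unfolding Q_def by simp
      ultimately show ?thesis by blast
    qed
  qed
  have prob: "gnpk_prob n p k (Q u) \<le> exp (- \<sigma>)" if u: "u \<in> I" for u
  proof -
    obtain i j v c s where ueq: "u = (i, j, v, c, s)" by (cases u)
    then have ijv: "i < k" "j < k" "i \<noteq> j" "v < n" and c: "c < (if s then 2 ^ m1 else 2 ^ m2)"
      using u unfolding I_def by auto
    show ?thesis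
    proof (cases s)
      case True
      have "inj_on (\<lambda>b. c + 2 ^ m1 * b) {..<(2::nat) ^ m2}" by (auto simp: inj_on_def)
      moreover have "c + 2 ^ m1 * b < n" if "b < 2 ^ m2" for b
        using add_mult_power_less[of c m1 b m2] that c True unfolding n_def by simp
      ultimately have "gnpk_prob n p k (\<lambda>E. real (card {b \<in> {..<2 ^ m2}. {(i, v), (j, c + 2 ^ m1 * b)} \<notin> E})
          > 2 * (1 - p) * real (2 ^ m2) + \<sigma>) \<le> exp (- \<sigma>)"
        by (rule gnpk_prob_many_nonneighbours[OF p ijv])
      then show ?thesis unfolding Q_def ueq using True by simp
    next
      case False
      have "inj_on (\<lambda>a. a + 2 ^ m1 * c) {..<(2::nat) ^ m1}" by (auto simp: inj_on_def)
      moreover have "a + 2 ^ m1 * c < n" if "a < 2 ^ m1" for a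
        using add_mult_power_less[of a m1 c m2] that c False unfolding n_def by simp
      ultimately have "gnpk_prob n p k (\<lambda>E. real (card {a \<in> {..<2 ^ m1}. {(i, v), (j, a + 2 ^ m1 * c)} \<notin> E})
          > 2 * (1 - p) * real (2 ^ m1) + \<sigma>) \<le> exp (- \<sigma>)"
        by (rule gnpk_prob_many_nonneighbours[OF p ijv])
      then show ?thesis unfolding Q_def ueq using False by simp
    qed
  qed
  have exp\<sigma>: "exp (- \<sigma>) = 1 / N ^ 4"
  proof -
    have "exp \<sigma> = exp (ln N) ^ 4" unfolding \<sigma>_def by (simp flip: exp_of_nat_mult)
    then show ?thesis using N1 by (simp add: exp_minus field_simps)
  qed
  have "gnpk_prob n p k (\<lambda>E. \<not> balanced m1 m2 k \<delta> E) \<le> gnpk_prob n p k (\<lambda>E. \<exists>u\<in>I. Q u E)"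
    by (rule gnpk_prob_mono[OF p bad])
  also have "\<dots> \<le> card I * exp (- \<sigma>)"
    by (rule gnpk_prob_union_bound[OF p finI prob])
  also have "\<dots> \<le> 2 * N ^ 2 * (1 / N ^ 4)"
    unfolding exp\<sigma> by (rule mult_right_mono[OF cardI]) simp
  also have "\<dots> = 2 / N ^ 2" using N1 by (simp add: field_simps power_def eval_nat_numeral)
  also have "\<dots> \<le> 2 / real n ^ 2"
    using Nn n1 by (intro divide_left_mono power_mono) auto
  finally show ?thesis .
qed

section \<open>The lower bound\<close>

text \<open>A single line has no premises, so \<open>0 \<ge> 1\<close> would have to be an axiom.
  Variable bounds have another right-hand side, and a clause mentions at least one variable. This
  settles the case of a small \<open>cp_bound\<close>.\<close>

lemma refutation_length_ge_2:
  assumes ref: "sem_cp_refutation k m (lin_system k m (binclique_block m k E)) R" and m: "m \<ge> 1"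
  shows "length R \<ge> 2"
proof (rule ccontr)
  assume "\<not> length R \<ge> 2"
  moreover have "R \<noteq> []" using ref unfolding sem_cp_refutation_def by blast
  ultimately obtain l where R: "R = [l]" by (cases R) (auto simp: Suc_le_eq)
  then have l: "l = ((\<lambda>_. 0), 1)" "l \<in> lin_system k m (binclique_block m k E)"
    using ref unfolding sem_cp_refutation_def by auto
  then obtain i v j w where "l = clause_ineq (block_clause m i v j w)" "i \<noteq> j"
    unfolding lin_system_def binclique_block_def by auto
  moreover define I where "I = fst (block_clause m i v j w)"
  moreover define J where "J = snd (block_clause m i v j w)"
  ultimately have *: "(\<lambda>u. (if u \<in> I then 1 else 0) - (if u \<in> J then 1 else 0)) = (\<lambda>_. 0 :: real)"
    "card J = 0"
    using l(1) unfolding clause_ineq_def by simp_all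
  have "finite J" unfolding J_def block_clause_def by simp
  then have "J = {}" using *(2) by simp
  then have "(i, 0) \<notin> I" using fun_cong[OF *(1), of "(i, 0)"] by (auto split: if_splits)
  then have "(i, 0) \<in> J" using m binbit_cases[of v 0] unfolding I_def J_def block_clause_def by auto
  then show False using \<open>J = {}\<close> by simp
qed

text \<open>The two terms of the minimum match the two terms of \<delta>: c^2 (1 - p) \<le> 1 and
  c^2 ln(kn) / 2^m1 \<le> 2, so c^2 \<delta> \<le> 2 * 1 + 4 * 2.\<close>

lemma cp_bound_estimates:
  fixes k m1 m2 :: nat and p :: real
  defines "n \<equiv> (2::nat) ^ (m1 + m2)"
  defines "\<delta> \<equiv> 2 * (1 - p) + 4 * ln (real (k * n)) / 2 ^ m1"
  assumes p: "0 \<le> p" "p \<le> 1" and k: "1 \<le> k" and m: "m1 + m2 \<ge> 2" "m2 \<le> m1 + 1"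
  shows "0 \<le> cp_bound n k p" "0 \<le> \<delta>" "cp_bound n k p ^ 2 * \<delta> \<le> 10"
proof -
  define c where "c = cp_bound n k p"
  define l where "l = ln (real (k * n))"
  \<comment> \<open>From n \<ge> 4 > e the logarithm is at least 1, which makes 2 / l \<le> 2
    below.\<close>
  have "(4::nat) \<le> n" using power_increasing[OF m(1), of "2::nat"] unfolding n_def by simp
  then have "4 \<le> k * n" using k by (metis mult_le_mono nat_mult_1)
  then have kn: "real (k * n) \<ge> 4" by linarith
  then have "exp 1 \<le> real (k * n)" using exp_le by linarith
  then have l1: "l \<ge> 1" unfolding l_def using kn by (subst ln_ge_iff) auto
  have c0: "0 \<le> c" unfolding c_def cp_bound_def l_def[symmetric] using l1 p by auto
  have cn: "c \<le> real n powr (1/4) / l" unfolding c_def cp_bound_def l_def[symmetric] by auto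
  have cp: "c ^ 2 * (1 - p) \<le> 1"
  proof (cases "p = 1")
    case False
    then have "1 - p > 0" using p by simp
    have "c \<le> 1 / sqrt (1 - p)" using False unfolding c_def cp_bound_def by simp
    then have "c ^ 2 \<le> (1 / sqrt (1 - p)) ^ 2" using c0 by (intro power_mono)
    also have "\<dots> = 1 / (1 - p)" using \<open>1 - p > 0\<close> by (simp add: power_divide)
    finally show ?thesis using \<open>1 - p > 0\<close> by (simp add: field_simps)
  qed simp
  \<comment> \<open>The nearly equal split of the bits gives n \<le> 4 * 4^m1, hence sqrt n \<le> 2
    * 2^m1.\<close>
  have "(2::real) ^ (m1 + m2) \<le> 2 ^ (2 * m1 + 2)" by (rule power_increasing) (use m(2) in auto)
  then have "real n \<le> 2 ^ (2 * m1 + 2)" unfolding n_def by simp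
  also have "\<dots> = (2 * 2 ^ m1) ^ 2" by (simp add: power_mult power_mult_distrib power_even_eq mult.commute)
  finally have "sqrt (real n) \<le> 2 * 2 ^ m1" by (intro real_le_lsqrt) auto
  moreover have "(real n powr (1/4)) ^ 2 = sqrt (real n)"
    by (simp add: power2_eq_square powr_half_sqrt flip: powr_add)
  ultimately have q: "(real n powr (1/4)) ^ 2 \<le> 2 * 2 ^ m1" by simp
  have "c ^ 2 \<le> (real n powr (1/4) / l) ^ 2" using cn c0 by (intro power_mono)
  also have "\<dots> \<le> 2 * 2 ^ m1 / l ^ 2" unfolding power_divide by (intro divide_right_mono q) simp
  finally have "c ^ 2 * (l / 2 ^ m1) \<le> 2 * 2 ^ m1 / l ^ 2 * (l / 2 ^ m1)"
    using l1 by (intro mult_right_mono) auto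
  also have "\<dots> = 2 / l" using l1 by (simp add: power2_eq_square)
  also have "\<dots> \<le> 2" using l1 by (simp add: field_simps)
  finally have "c ^ 2 * (l / 2 ^ m1) \<le> 2" .
  moreover have "c ^ 2 * \<delta> = 2 * (c ^ 2 * (1 - p)) + 4 * (c ^ 2 * (l / 2 ^ m1))"
    unfolding \<delta>_def l_def by (simp add: algebra_simps)
  ultimately show "cp_bound n k p ^ 2 * \<delta> \<le> 10" using cp unfolding c_def by linarith
  show "0 \<le> cp_bound n k p" using c0 unfolding c_def .
  show "0 \<le> \<delta>" unfolding \<delta>_def l_def[symmetric] using p l1 by simp
qed

text \<open>With d about c/40 one gets \<rho> = 16 d^2 \<delta> \<le> 1/10, so the errors must add
  up to at least 9/10 and the length is at least 9 * 10^d \<ge> exp(d + 1).\<close>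

lemma balanced_refutation_length:
  fixes k m1 m2 :: nat and p :: real
  defines "n \<equiv> (2::nat) ^ (m1 + m2)"
  assumes p: "0 \<le> p" "p \<le> 1" and k: "1 \<le> k" and m: "m1 + m2 \<ge> 2" "m2 \<le> m1 + 1"
    and bal: "balanced m1 m2 k (2 * (1 - p) + 4 * ln (real (k * n)) / 2 ^ m1) E"
    and ref: "sem_cp_refutation k (m1 + m2) (lin_system k (m1 + m2) (binclique_block (m1 + m2) k E)) R"
  shows "exp (cp_bound n k p / 80) \<le> length R"
proof -
  define \<delta> where "\<delta> = 2 * (1 - p) + 4 * ln (real (k * n)) / 2 ^ m1"
  define c where "c = cp_bound n k p"
  have est: "0 \<le> c" "0 \<le> \<delta>" "c ^ 2 * \<delta> \<le> 10"
    using cp_bound_estimates[OF p k m] unfolding c_def \<delta>_def n_def by blast+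
  show ?thesis
  proof (cases "c < 40")
    \<comment> \<open>Here the choice of \<open>d\<close> would be 0. The constant 80 makes the
      claim follow from exp(1/2) \<le> 2 and the trivial length bound.\<close>
    case True
    have "exp (c / 80) \<le> exp (1 / 2)" using True by simp
    also have "\<dots> \<le> 2"
    proof (rule power2_le_imp_le)
      have "exp (1 / 2) ^ 2 = exp (1::real)" by (simp flip: exp_of_nat_mult)
      then show "exp (1 / 2) ^ 2 \<le> (2::real) ^ 2" using exp_le by simp
    qed simp
    also have "2 \<le> real (length R)" using refutation_length_ge_2[OF ref] m by simp
    finally show ?thesis unfolding c_def .
  next
    case False
    define d where "d = nat \<lfloor>c / 40\<rfloor>"
    have d: "d \<ge> 1" "real d \<le> c / 40" "c / 40 \<le> real (Suc d)"
      using False unfolding d_def by (auto simp: le_nat_floor) linarith+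
    define \<rho> where "\<rho> = real (4 * d) ^ 2 * \<delta>"
    have \<rho>0: "\<rho> \<ge> 0" using est by (simp add: \<rho>_def)
    have "real (4 * d) ^ 2 \<le> (c / 10) ^ 2" using d(2) by (intro power_mono) auto
    then have "\<rho> \<le> (c / 10) ^ 2 * \<delta>" unfolding \<rho>_def using est(2) by (rule mult_right_mono)
    also have "\<dots> = c ^ 2 * \<delta> / 100" by (simp add: power_divide)
    also have "\<dots> \<le> 1 / 10" using est(3) by linarith
    finally have \<rho>: "\<rho> \<le> 1 / 10" .
    have "1 \<le> length R * \<rho> ^ Suc d + \<rho>"
      unfolding \<rho>_def
    proof (rule refutation_length_bound[OF refl est(2) d(1) _ _ ref])
      show "real (card {b \<in> {..<2 ^ m2}. {(i, v), (j, a + 2 ^ m1 * b)} \<notin> E}) \<le> \<delta> * 2 ^ m2"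
        if "i < k" "j < k" "i \<noteq> j" "v < 2 ^ (m1 + m2)" "a < 2 ^ m1" for i j v a
        using bal that unfolding balanced_def \<delta>_def by blast
      show "real (card {a \<in> {..<2 ^ m1}. {(i, v), (j, a + 2 ^ m1 * b)} \<notin> E}) \<le> \<delta> * 2 ^ m1"
        if "i < k" "j < k" "i \<noteq> j" "v < 2 ^ (m1 + m2)" "b < 2 ^ m2" for i j v b
        using bal that unfolding balanced_def \<delta>_def by blast
    qed
    moreover have "length R * \<rho> ^ Suc d \<le> length R * (1 / 10) ^ Suc d"
      using \<rho> \<rho>0 by (intro mult_left_mono power_mono) auto
    ultimately have "9 / 10 \<le> length R * (1 / 10) ^ Suc d" using \<rho> by linarith
    then have "9 * 10 ^ d \<le> real (length R)" by (simp add: power_divide field_simps)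
    moreover have "3 ^ Suc d \<le> 9 * (10::real) ^ d"
      unfolding power_Suc by (intro mult_mono power_mono) auto
    moreover have "exp (real (Suc d)) \<le> 3 ^ Suc d"
    proof -
      have "exp (real (Suc d)) = exp 1 ^ Suc d" by (metis exp_of_nat_mult mult.right_neutral)
      also have "\<dots> \<le> 3 ^ Suc d" using exp_le by (intro power_mono) auto
      finally show ?thesis .
    qed
    moreover have "exp (c / 80) \<le> exp (real (Suc d))" using d(3) est(1) by simp
    ultimately show ?thesis unfolding c_def by linarith
  qed
qed

theorem theorem4p1:
  shows "\<exists>C > 0. \<forall>(k :: nat \<Rightarrow> nat) (p :: nat \<Rightarrow> real).
     (\<forall>m. 0 \<le> p m \<and> p m \<le> 1) \<longrightarrow>
     ((\<lambda>m. gnpk_prob (2 ^ m) (p m) (k m)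
         (\<lambda>E. \<forall>R. sem_cp_refutation (k m) m (lin_system (k m) m (binclique_block m (k m) E)) R
                  \<longrightarrow> real (length R) \<ge> exp (C * cp_bound (2 ^ m) (k m) (p m))))
      \<longlongrightarrow> 1) sequentially"
proof (rule exI[of _ "1 / 80"], intro conjI allI impI)
  fix k :: "nat \<Rightarrow> nat" and p :: "nat \<Rightarrow> real"
  assume p: "\<forall>m. 0 \<le> p m \<and> p m \<le> 1"
  define long where "long m E \<longleftrightarrow>
      (\<forall>R. sem_cp_refutation (k m) m (lin_system (k m) m (binclique_block m (k m) E)) R
        \<longrightarrow> real (length R) \<ge> exp (1 / 80 * cp_bound (2 ^ m) (k m) (p m)))" for m E
  define f where "f m = gnpk_prob (2 ^ m) (p m) (k m) (long m)" for m
  \<comment> \<open>The failure probability is at most 2/n^2, uniformly in \<open>k\<close> and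
    \<open>p\<close>, which may therefore vary freely with \<open>m\<close>.\<close>
  have lower: "1 - 2 * (1 / 4) ^ m \<le> f m" if m: "m \<ge> 2" for m
  proof -
    have pm: "0 \<le> p m" "p m \<le> 1" using p by auto
    have "gnpk_prob (2 ^ m) (p m) (k m) (\<lambda>E. \<not> long m E) \<le> 2 * (1 / 4) ^ m"
    proof (cases "k m = 0")
      \<comment> \<open>Without blocks, ln 0 = 0 and division by 0 yields 0, so
        \<open>cp_bound\<close> is at most 0 and a refutation only has to be nonempty.\<close>
      case True
      then have "cp_bound (2 ^ m) (k m) (p m) \<le> 0" unfolding cp_bound_def by auto
      then have "exp (1 / 80 * cp_bound (2 ^ m) (k m) (p m)) \<le> 1" by simp
      moreover have "real (length R) \<ge> 1" if "sem_cp_refutation (k m) m S R" for S R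
        using that unfolding sem_cp_refutation_def by (cases R) auto
      ultimately have "long m E" for E unfolding long_def by (meson order_trans)
      then show ?thesis by (simp add: gnpk_prob_def)
    next
      case False
      \<comment> \<open>Alice gets the shorter half when \<open>m\<close> is odd; the two halves
        differ by at most one bit.\<close>
      define m1 where "m1 = m div 2"
      define m2 where "m2 = m - m1"
      have m12: "m = m1 + m2" "m1 \<le> m2" "m2 \<le> m1 + 1" unfolding m1_def m2_def by auto
      define \<delta> where "\<delta> = 2 * (1 - p m) + 4 * ln (real (k m * 2 ^ m)) / 2 ^ m1"
      have k: "1 \<le> k m" using False by simp
      have "balanced m1 m2 (k m) \<delta> E \<Longrightarrow> long m E" for E
        using balanced_refutation_length[OF pm k _ m12(3), of E] m
        unfolding long_def \<delta>_def m12(1)[symmetric] by simp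
      then have "gnpk_prob (2 ^ m) (p m) (k m) (\<lambda>E. \<not> long m E)
          \<le> gnpk_prob (2 ^ m) (p m) (k m) (\<lambda>E. \<not> balanced m1 m2 (k m) \<delta> E)"
        by (intro gnpk_prob_mono[OF pm]) blast
      also have "\<dots> \<le> 2 / real (2 ^ m) ^ 2"
        using gnpk_prob_not_balanced[OF pm k m12(2) refl] unfolding \<delta>_def m12(1)[symmetric] .
      also have "\<dots> = 2 * (1 / 4) ^ m"
        by (simp add: power_divide power2_eq_square flip: power_mult_distrib)
      finally show ?thesis .
    qed
    then show ?thesis
      using gnpk_prob_compl[of "2 ^ m" "p m" "k m" "long m"] unfolding f_def by linarith
  qed
  have "(\<lambda>m. 1 - 2 * (1 / 4 :: real) ^ m) \<longlonglongrightarrow> 1 - 2 * 0"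
    by (intro tendsto_intros LIMSEQ_realpow_zero) auto
  then have lim: "(\<lambda>m. 1 - 2 * (1 / 4 :: real) ^ m) \<longlonglongrightarrow> 1" by simp
  have "f \<longlonglongrightarrow> 1"
  proof (rule tendsto_sandwich[OF _ _ lim tendsto_const])
    show "\<forall>\<^sub>F m in sequentially. 1 - 2 * (1 / 4) ^ m \<le> f m"
      using lower by (auto simp: eventually_sequentially)
    show "\<forall>\<^sub>F m in sequentially. f m \<le> 1"
      unfolding f_def using gnpk_prob_le_1 p by simp
  qed
  then show "((\<lambda>m. gnpk_prob (2 ^ m) (p m) (k m)
         (\<lambda>E. \<forall>R. sem_cp_refutation (k m) m (lin_system (k m) m (binclique_block m (k m) E)) R
                  \<longrightarrow> real (length R) \<ge> exp (1 / 80 * cp_bound (2 ^ m) (k m) (p m))))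
      \<longlongrightarrow> 1) sequentially"
    unfolding f_def long_def .
qed simp

end
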